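(* Let $G$ be any countable discrete sofic group and $\Sigma$ any sofic approximation to $G$. Then Bernoulli systems over $G$ have connected model spaces rel $\Sigma$: that is, for every standard probability space $(\mathcal{X},\nu)$, the $G$-system $(\mathcal{X}^G,\nu^{\times G},S)$ has connected model spaces rel $\Sigma$.
   Context: Sofic approximations and systems. A sofic approximation to $G$ is a sequence $\Sigma=(\sigma_n)_{n\ge 1}$ of maps $\sigma_n:G\to\mathrm{Sym}(V_n)$, $g\mapsto\sigma_n^g$, where $V_n$ are finite sets with $|V_n|\to\infty$, such that for all $g,h\in G$ the proportion of $v\in V_n$ with $\sigma_n^g(\sigma_n^h(v))=\sigma_n^{gh}(v)$ tends to $1$, and for all $g\neq h$ the proportion of $v\in V_n$ with $\sigma_n^g(v)\ne\sigma_n^h(v)$ tends to $1$. A $G$-system $(X,\mu,T)$ is a standard probability space $(X,\mu)$ with a measurable $\mu$-preserving action $T$ of $G$. A factor map between $G$-systems is a measurable map, equivariant a.e., pushing the first measure to the second; it is an isomorphism if it is invertible modulo null sets. Metric $G$-processes. A metric $G$-process $(\mathcal{X}^G,\mu,S,d)$ consists of a standard measurable space $\mathcal{X}$, a compact metric $d$ on $\mathcal{X}$ whose Borel $\sigma$-algebra is that of $\mathcal{X}$, the right-shift action $(S^h x)_g=x_{gh}$ of $G$ on $\mathcal{X}^G$, and an $S$-invariant probability measure $\mu$ on $\mathcal{X}^G$. The weak$^\ast$ topology on $\mathrm{Prob}(\mathcal{X}^G)$ (Borel probability measures) refers to the product topology on $\mathcal{X}^G$ arising from $d$. For finite $V$,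 $d^{(V)}(\mathbf{x},\mathbf{x}')=\frac1{|V|}\sum_{v\in V}d(x_v,x'_v)$ on $\mathcal{X}^V$. Models. For $\sigma:G\to\mathrm{Sym}(V)$, $v\in V$, $\mathbf{x}\in\mathcal{X}^V$, put $\Pi^\sigma_v(\mathbf{x})=(x_{\sigma^g(v)})_{g\in G}\in\mathcal{X}^G$ and $P^\sigma_{\mathbf{x}}=\frac1{|V|}\sum_{v\in V}\delta_{\Pi^\sigma_v(\mathbf{x})}$ (empirical distribution). For a weak$^\ast$-neighbourhood $\mathcal{O}$ of $\mu$, $\Omega(\mathcal{O},\sigma_n)=\{\mathbf{x}\in\mathcal{X}^{V_n}:P^{\sigma_n}_{\mathbf{x}}\in\mathcal{O}\}$. Connected model spaces. A $\delta$-path from $x$ to $y$ in a metric space $(Y,d_Y)$ is a finite sequence $x=x_0,\dots,x_\ell=y$ with $d_Y(x_i,x_{i+1})<\delta$ for all $0\le i<\ell$. A metric $G$-process $(\mathcal{X}^G,\mu,S,d)$ has connected model spaces rel $\Sigma$ if: whenever $n_1<n_2<\cdots$ and $\mathbf{x}_i,\mathbf{y}_i\in\mathcal{X}^{V_{n_i}}$ satisfy $P^{\sigma_{n_i}}_{\mathbf{x}_i}\to\mu$ and $P^{\sigma_{n_i}}_{\mathbf{y}_i}\to\mu$ weak$^\ast$, there are $\delta_i\downarrow0$ and $\delta_i$-paths $\mathbf{x}_i=\mathbf{x}_{i,0},\dots,\mathbf{x}_{i,\ell_i}=\mathbf{y}_i$ in $(\mathcal{X}^{V_{n_i}},d^{(V_{n_i})})$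 such that for every weak$^\ast$-neighbourhood $\mathcal{O}$ of $\mu$ we have $\{\mathbf{x}_{i,j}:0\le j\le\ell_i\}\subseteq\Omega(\mathcal{O},\sigma_{n_i})$ for all sufficiently large $i$. Extension to general systems. Having connected model spaces rel $\Sigma$ is known to be independent of the choice of $d$ and invariant under isomorphism of the systems $(\mathcal{X}^G,\mu,S)$. Every $G$-system is isomorphic to some $(\mathcal{X}^G,\mu,S)$ underlying a metric $G$-process; a $G$-system has connected model spaces rel $\Sigma$ if one (equivalently, every) metric $G$-process to which it is isomorphic does. *)

theory Defs
  imports
    "HOL-Probability.Probability"
    "HOL-Algebra.Group"
    "HOL-Combinatorics.Permutations"
begin

definition sofic_approximation ::
  "('g, 'b) monoid_scheme \<Rightarrow> (nat \<Rightarrow> 'v set) \<Rightarrow> (nat \<Rightarrow> 'g \<Rightarrow> 'v \<Rightarrow> 'v) \<Rightarrow> bool" where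
  "sofic_approximation G V \<sigma> \<longleftrightarrow>
     (\<forall>n. finite (V n)) \<and>
     filterlim (\<lambda>n. card (V n)) at_top sequentially \<and>
     (\<forall>n. \<forall>g\<in>carrier G. \<sigma> n g permutes V n) \<and>
     (\<forall>g\<in>carrier G. \<forall>h\<in>carrier G.
        (\<lambda>n. real (card {v \<in> V n. \<sigma> n g (\<sigma> n h v) = \<sigma> n (g \<otimes>\<^bsub>G\<^esub> h) v}) / real (card (V n)))
          \<longlonglongrightarrow> 1) \<and>
     (\<forall>g\<in>carrier G. \<forall>h\<in>carrier G. g \<noteq> h \<longrightarrow>
        (\<lambda>n. real (card {v \<in> V n. \<sigma> n g v \<noteq> \<sigma> n h v}) / real (card (V n)))
          \<longlonglongrightarrow> 1)"

definition standard_borel :: "'a measure \<Rightarrow> bool" where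
  "standard_borel M \<longleftrightarrow>
     (\<exists>T. topspace T = space M \<and> completely_metrizable_space T \<and> second_countable T \<and>
          sets M = sigma_sets (space M) {U. openin T U})"

definition g_system ::
  "('g, 'b) monoid_scheme \<Rightarrow> 'a measure \<Rightarrow> ('g \<Rightarrow> 'a \<Rightarrow> 'a) \<Rightarrow> bool" where
  "g_system G \<mu> T \<longleftrightarrow>
     standard_borel \<mu> \<and> prob_space \<mu> \<and>
     (\<forall>g\<in>carrier G. T g \<in> measurable \<mu> \<mu> \<and> distr \<mu> \<mu> (T g) = \<mu>) \<and>
     (\<forall>x\<in>space \<mu>. T \<one>\<^bsub>G\<^esub> x = x) \<and>
     (\<forall>g\<in>carrier G. \<forall>h\<in>carrier G. \<forall>x\<in>space \<mu>. T (g \<otimes>\<^bsub>G\<^esub> h) x = T g (T h x))"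

definition factor_map ::
  "('g, 'b) monoid_scheme \<Rightarrow> 'a measure \<Rightarrow> ('g \<Rightarrow> 'a \<Rightarrow> 'a) \<Rightarrow>
   'c measure \<Rightarrow> ('g \<Rightarrow> 'c \<Rightarrow> 'c) \<Rightarrow> ('a \<Rightarrow> 'c) \<Rightarrow> bool" where
  "factor_map G \<mu> T \<nu> R \<Phi> \<longleftrightarrow>
     \<Phi> \<in> measurable \<mu> \<nu> \<and> distr \<mu> \<nu> \<Phi> = \<nu> \<and>
     (\<forall>g\<in>carrier G. AE x in \<mu>. \<Phi> (T g x) = R g (\<Phi> x))"

definition isomorphic_systems ::
  "('g, 'b) monoid_scheme \<Rightarrow> 'a measure \<Rightarrow> ('g \<Rightarrow> 'a \<Rightarrow> 'a) \<Rightarrow>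
   'c measure \<Rightarrow> ('g \<Rightarrow> 'c \<Rightarrow> 'c) \<Rightarrow> bool" where
  "isomorphic_systems G \<mu> T \<nu> R \<longleftrightarrow>
     (\<exists>\<Phi> \<Psi>. factor_map G \<mu> T \<nu> R \<Phi> \<and> \<Psi> \<in> measurable \<nu> \<mu> \<and>
            (AE x in \<mu>. \<Psi> (\<Phi> x) = x) \<and> (AE y in \<nu>. \<Phi> (\<Psi> y) = y))"

text \<open>
  A point of the full shift over the alphabet \<open>space M\<close> is an extensional function on
  \<open>carrier G\<close>; the measurable space is the product of copies of \<open>M\<close>.
\<close>

definition right_shift :: "('g, 'b) monoid_scheme \<Rightarrow> 'g \<Rightarrow> ('g \<Rightarrow> 'x) \<Rightarrow> 'g \<Rightarrow> 'x" where
  "right_shift G h x = (\<lambda>g\<in>carrier G. x (g \<otimes>\<^bsub>G\<^esub> h))"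

abbreviation shift_space :: "('g, 'b) monoid_scheme \<Rightarrow> 'x measure \<Rightarrow> ('g \<Rightarrow> 'x) measure" where
  "shift_space G M \<equiv> Pi\<^sub>M (carrier G) (\<lambda>_. M)"

definition shift_topology ::
  "('g, 'b) monoid_scheme \<Rightarrow> 'x measure \<Rightarrow> ('x \<Rightarrow> 'x \<Rightarrow> real) \<Rightarrow> ('g \<Rightarrow> 'x) topology" where
  "shift_topology G M d =
     product_topology (\<lambda>_. Metric_space.mtopology (space M) d) (carrier G)"

text \<open>
  Only the measurable structure of \<open>M\<close> is relevant here; its measure plays no role.
\<close>

definition metric_process ::
  "('g, 'b) monoid_scheme \<Rightarrow> 'x measure \<Rightarrow> ('x \<Rightarrow> 'x \<Rightarrow> real) \<Rightarrow> ('g \<Rightarrow> 'x) measure \<Rightarrow> bool" where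
  "metric_process G M d \<mu> \<longleftrightarrow>
     standard_borel M \<and>
     Metric_space (space M) d \<and>
     compact_space (Metric_space.mtopology (space M) d) \<and>
     sets M = sigma_sets (space M) {U. openin (Metric_space.mtopology (space M) d) U} \<and>
     \<mu> \<in> space (prob_algebra (shift_space G M)) \<and>
     (\<forall>h\<in>carrier G. distr \<mu> \<mu> (right_shift G h) = \<mu>)"

text \<open>
  The coarsest topology on the probability measures on \<open>N\<close> that makes the integrals of all
  continuous functions continuous. It is used for compact \<open>T\<close> whose Borel sets are those of
  \<open>N\<close>, so boundedness of the test functions is automatic. (For countable \<open>G\<close> and a compact
  metric alphabet, the product \<open>\<sigma>\<close>-algebra is the Borel \<open>\<sigma>\<close>-algebra of the product topology.)
\<close>

definition weak_star_topology :: "'a topology \<Rightarrow> 'a measure \<Rightarrow> 'a measure topology" where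
  "weak_star_topology T N =
     topology_generated_by
       {{\<mu> \<in> space (prob_algebra N). (\<integral>x. f x \<partial>\<mu>) \<in> U} | f U.
          continuous_map T euclideanreal f \<and> open U}"

abbreviation shift_weak_star ::
  "('g, 'b) monoid_scheme \<Rightarrow> 'x measure \<Rightarrow> ('x \<Rightarrow> 'x \<Rightarrow> real) \<Rightarrow> ('g \<Rightarrow> 'x) measure topology" where
  "shift_weak_star G M d \<equiv> weak_star_topology (shift_topology G M d) (shift_space G M)"

definition pullback_name ::
  "('g, 'b) monoid_scheme \<Rightarrow> ('g \<Rightarrow> 'v \<Rightarrow> 'v) \<Rightarrow> 'v \<Rightarrow> ('v \<Rightarrow> 'x) \<Rightarrow> 'g \<Rightarrow> 'x" where
  "pullback_name G s v x = (\<lambda>g\<in>carrier G. x (s g v))"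

text \<open>
  The average of the point masses at the pullback names, as the law of the pullback name at a
  uniformly random vertex.
\<close>

definition empirical_distribution ::
  "('g, 'b) monoid_scheme \<Rightarrow> 'x measure \<Rightarrow> 'v set \<Rightarrow> ('g \<Rightarrow> 'v \<Rightarrow> 'v) \<Rightarrow> ('v \<Rightarrow> 'x) \<Rightarrow>
   ('g \<Rightarrow> 'x) measure" where
  "empirical_distribution G M V s x =
     distr (uniform_count_measure V) (shift_space G M) (\<lambda>v. pullback_name G s v x)"

definition good_models ::
  "('g, 'b) monoid_scheme \<Rightarrow> 'x measure \<Rightarrow> ('g \<Rightarrow> 'x) measure set \<Rightarrow> 'v set \<Rightarrow>
   ('g \<Rightarrow> 'v \<Rightarrow> 'v) \<Rightarrow> ('v \<Rightarrow> 'x) set" where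
  "good_models G M U V s =
     {x \<in> V \<rightarrow>\<^sub>E space M. empirical_distribution G M V s x \<in> U}"

definition hamming_metric ::
  "'v set \<Rightarrow> ('x \<Rightarrow> 'x \<Rightarrow> real) \<Rightarrow> ('v \<Rightarrow> 'x) \<Rightarrow> ('v \<Rightarrow> 'x) \<Rightarrow> real" where
  "hamming_metric V d x y = (\<Sum>v\<in>V. d (x v) (y v)) / real (card V)"

definition delta_path ::
  "'a set \<Rightarrow> ('a \<Rightarrow> 'a \<Rightarrow> real) \<Rightarrow> real \<Rightarrow> 'a \<Rightarrow> 'a \<Rightarrow> 'a list \<Rightarrow> bool" where
  "delta_path Y D \<delta> x y p \<longleftrightarrow>
     p \<noteq> [] \<and> set p \<subseteq> Y \<and> hd p = x \<and> last p = y \<and> successively (\<lambda>a b. D a b < \<delta>) p"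

definition process_has_connected_model_spaces ::
  "('g, 'b) monoid_scheme \<Rightarrow> (nat \<Rightarrow> 'v set) \<Rightarrow> (nat \<Rightarrow> 'g \<Rightarrow> 'v \<Rightarrow> 'v) \<Rightarrow>
   'x measure \<Rightarrow> ('x \<Rightarrow> 'x \<Rightarrow> real) \<Rightarrow> ('g \<Rightarrow> 'x) measure \<Rightarrow> bool" where
  "process_has_connected_model_spaces G V \<sigma> M d \<mu> \<longleftrightarrow>
     (\<forall>n :: nat \<Rightarrow> nat. \<forall>x y.
        strict_mono n \<longrightarrow>
        (\<forall>i. x i \<in> V (n i) \<rightarrow>\<^sub>E space M) \<longrightarrow>
        (\<forall>i. y i \<in> V (n i) \<rightarrow>\<^sub>E space M) \<longrightarrow>
        limitin (shift_weak_star G M d)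
          (\<lambda>i. empirical_distribution G M (V (n i)) (\<sigma> (n i)) (x i)) \<mu> sequentially \<longrightarrow>
        limitin (shift_weak_star G M d)
          (\<lambda>i. empirical_distribution G M (V (n i)) (\<sigma> (n i)) (y i)) \<mu> sequentially \<longrightarrow>
        (\<exists>\<delta> p.
           (\<forall>i. 0 < \<delta> i) \<and> decseq \<delta> \<and> \<delta> \<longlonglongrightarrow> 0 \<and>
           (\<forall>i. delta_path (V (n i) \<rightarrow>\<^sub>E space M) (hamming_metric (V (n i)) d) (\<delta> i)
                  (x i) (y i) (p i)) \<and>
           (\<forall>U. openin (shift_weak_star G M d) U \<and> \<mu> \<in> U \<longrightarrow>
              (\<forall>\<^sub>F i in sequentially.
                 set (p i) \<subseteq> good_models G M U (V (n i)) (\<sigma> (n i))))))"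

text \<open>
  The definition asks for one metric process, isomorphic to the given system, that has connected
  model spaces. HOL cannot quantify over the type of the alphabet; taking it to be a subset of
  the reals, with arbitrary measurable structure and metric, loses nothing: a standard measurable
  space has at most the cardinality of the continuum, so its structure can be transported along
  an injection into the reals.
\<close>

definition has_connected_model_spaces ::
  "('g, 'b) monoid_scheme \<Rightarrow> (nat \<Rightarrow> 'v set) \<Rightarrow> (nat \<Rightarrow> 'g \<Rightarrow> 'v \<Rightarrow> 'v) \<Rightarrow>
   'a measure \<Rightarrow> ('g \<Rightarrow> 'a \<Rightarrow> 'a) \<Rightarrow> bool" where
  "has_connected_model_spaces G V \<sigma> \<mu> T \<longleftrightarrow>
     g_system G \<mu> T \<and>
     (\<exists>(M :: real measure) d \<nu>.
        metric_process G M d \<nu> \<and>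
        isomorphic_systems G \<mu> T \<nu> (right_shift G) \<and>
        process_has_connected_model_spaces G V \<sigma> M d \<nu>)"

end

theory Submission
  imports Defs
begin

text \<open>
  Up to isomorphism the alphabet is the unit interval: a standard Borel space is a measurable
  retract of \<open>{0..1}\<close>, and applying the encoding to all coordinates identifies the given Bernoulli
  system with one whose alphabet carries a law \<open>L\<close> on \<open>{0..1}\<close> and the usual metric
  (lemmas \<open>standard_borel_retract_of_interval\<close> and \<open>isomorphic_bernoulli_retract\<close>).

  Let \<open>x\<close> and \<open>y\<close> be two good models over the vertex set \<open>V\<close>. Give each vertex, independently, a fresh
  symbol \<open>z\<close> of law \<open>L\<close> and a uniform label in \<open>{..<K}\<close>. Replacing the symbols of \<open>x\<close> by the fresh ones,
  one label after the other, leads from \<open>x\<close> to \<open>z\<close> in \<open>K\<close> steps, each of which changes about \<open>1 / K\<close> of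
  the vertices. The same procedure, with the same choices, leads from \<open>y\<close> to \<open>z\<close>, and the two walks
  together form the path.

  All points on the path are good models for most choices. At a typical vertex \<open>v\<close> the points \<open>\<sigma> g v\<close>,
  for \<open>g\<close> in a finite window, are distinct, so the expected pattern seen from \<open>v\<close> is the pattern of \<open>x\<close>
  with each symbol replaced independently with probability \<open>k / K\<close>. As the patterns of \<open>x\<close> are
  distributed almost according to the Bernoulli measure, and this replacement preserves that measure,
  the expectation is right (lemma \<open>integral_mixed_monomial\<close>). Deviations from it are small because
  patterns at vertices with disjoint windows are independent: the second moment of the vertex average
  is of order \<open>1 / card V\<close>, apart from the few vertices whose window is not injective
  (lemma \<open>second_moment_vertex_average\<close>).

  It suffices to test measures against monomials in the coordinates, which are dense by the
  Stone--Weierstrass theorem (lemma \<open>eventually_in_weak_star_nbhd\<close>). Monomials factor over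
  coordinates, so all expectations are products. They are also countable in number, so that
  a diagonal argument produces a single sequence of paths for all neighbourhoods.
\<close>

section \<open>Second moments of vertex averages\<close>

text \<open>
The index set \<open>V\<close> may be infinite, so this serves both the random choices at the vertices of a
finite set and the Bernoulli measure itself: only the finitely many distinct coordinates
\<open>s g\<close> matter, and their joint law is a finite product.
\<close>

lemma integral_prod_distinct_coordinates:
  fixes u :: "'i \<Rightarrow> 'a \<Rightarrow> real"
  assumes Q: "prob_space Q" and F: "finite F" and s: "inj_on s F" "s ` F \<subseteq> V"
    and u: "\<And>g. g \<in> F \<Longrightarrow> integrable Q (u g)"
  shows "(\<integral>\<omega>. (\<Prod>g\<in>F. u g (\<omega> (s g))) \<partial>(\<Pi>\<^sub>M v\<in>V. Q)) = (\<Prod>g\<in>F. \<integral>a. u g a \<partial>Q)"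
proof -
  interpret Q: prob_space Q by (rule Q)
  interpret product_sigma_finite "\<lambda>_. Q"
    by (simp add: product_sigma_finite_def Q.sigma_finite_measure_axioms)
  have [measurable]: "u g \<in> borel_measurable Q" if "g \<in> F" for g
    using u[OF that] by simp
  have reindex: "distr (\<Pi>\<^sub>M v\<in>V. Q) (\<Pi>\<^sub>M g\<in>F. Q) (\<lambda>\<omega>. \<lambda>g\<in>F. \<omega> (s g)) = (\<Pi>\<^sub>M g\<in>F. Q)"
    using s Q by (intro distr_PiM_reindex) auto
  have "(\<lambda>\<omega>. \<lambda>g\<in>F. \<omega> (s g)) \<in> (\<Pi>\<^sub>M v\<in>V. Q) \<rightarrow>\<^sub>M (\<Pi>\<^sub>M g\<in>F. Q)"
    using s(2) by (intro measurable_restrict) (auto intro: measurable_component_singleton)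
  then have "(\<integral>\<omega>. (\<Prod>g\<in>F. u g (\<omega> (s g))) \<partial>(\<Pi>\<^sub>M v\<in>V. Q))
      = (\<integral>\<omega>. (\<Prod>g\<in>F. u g (\<omega> g)) \<partial>distr (\<Pi>\<^sub>M v\<in>V. Q) (\<Pi>\<^sub>M g\<in>F. Q) (\<lambda>\<omega>. \<lambda>g\<in>F. \<omega> (s g)))"
    by (subst integral_distr) auto
  also have "\<dots> = (\<integral>\<omega>. (\<Prod>g\<in>F. u g (\<omega> g)) \<partial>(\<Pi>\<^sub>M g\<in>F. Q))"
    by (simp only: reindex)
  also have "\<dots> = (\<Prod>g\<in>F. \<integral>a. u g a \<partial>Q)"
    using F u by (rule product_integral_prod)
  finally show ?thesis .
qed

text \<open>
Outside these pairs the neighbourhoods of \<open>v\<close> and \<open>v'\<close> under \<open>s\<close> are disjoint. Since each \<open>s g'\<close> is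
a permutation, \<open>v\<close>, \<open>g\<close> and \<open>g'\<close> determine the \<open>v'\<close> with \<open>s g v = s g' v'\<close>; so there are only
linearly many pairs apart from those involving \<open>B\<close>.
\<close>

lemma card_dependent_pairs_le:
  fixes s :: "'g \<Rightarrow> 'v \<Rightarrow> 'v"
  assumes V: "finite V" and F: "finite F" and s: "\<And>g. g \<in> F \<Longrightarrow> s g permutes V"
    and B: "B \<subseteq> V"
  shows "card {(v, v') \<in> V \<times> V. v \<in> B \<or> v' \<in> B \<or> (\<exists>g\<in>F. \<exists>g'\<in>F. s g v = s g' v')}
           \<le> (2 * card B + (card F)\<^sup>2) * card V"
    (is "card ?P \<le> _")
proof -
  let ?C = "\<lambda>(g, g'). (\<lambda>v. (v, inv_into V (s g') (s g v))) ` V"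
  have inj: "inj_on (s g) V" if "g \<in> F" for g
    using s[OF that] by (rule permutes_inj_on)
  have "?P \<subseteq> B \<times> V \<union> V \<times> B \<union> (\<Union>p\<in>F \<times> F. ?C p)"
    using inj by (fastforce simp: inv_into_f_f)
  moreover have "finite (B \<times> V \<union> V \<times> B \<union> (\<Union>p\<in>F \<times> F. ?C p))"
    using V F B by (auto intro: finite_subset)
  ultimately have "card ?P \<le> card (B \<times> V \<union> V \<times> B \<union> (\<Union>p\<in>F \<times> F. ?C p))"
    by (rule card_mono[rotated])
  also have "\<dots> \<le> card (B \<times> V) + card (V \<times> B) + card (\<Union>p\<in>F \<times> F. ?C p)"
    by (meson card_Un_le le_trans add_le_mono1)
  also have "card (\<Union>p\<in>F \<times> F. ?C p) \<le> (\<Sum>p\<in>F \<times> F. card (?C p))"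
    using F by (intro card_UN_le) auto
  also have "\<dots> \<le> (\<Sum>p\<in>F \<times> F. card V)"
    by (intro sum_mono) (auto intro: card_image_le[OF V])
  finally show ?thesis
    by (simp add: card_cartesian_product algebra_simps power2_eq_square)
qed

text \<open>
A weak law of large numbers. The summand at \<open>v\<close> depends only on the independent choices at the
vertices \<open>s g v\<close>. Unless a pair \<open>v, v'\<close> is one of those counted above, with \<open>B\<close> the set of vertices
whose neighbours \<open>s g v\<close> are not distinct, the two summands are independent and centred, hence
uncorrelated. Every other pair contributes at most \<open>2 * 2\<close>.
\<close>

lemma second_moment_vertex_average:
  fixes u :: "'v \<Rightarrow> 'g \<Rightarrow> 'a \<Rightarrow> real" and s :: "'g \<Rightarrow> 'v \<Rightarrow> 'v"
  assumes Q: "prob_space Q" and V: "finite V" "V \<noteq> {}" and F: "finite F"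
    and s: "\<And>g. g \<in> F \<Longrightarrow> s g permutes V"
    and u: "\<And>v g. v \<in> V \<Longrightarrow> g \<in> F \<Longrightarrow> u v g \<in> borel_measurable Q"
    and u_le: "\<And>v g a. v \<in> V \<Longrightarrow> g \<in> F \<Longrightarrow> a \<in> space Q \<Longrightarrow> \<bar>u v g a\<bar> \<le> 1"
  defines "D \<equiv> \<lambda>v \<omega>. (\<Prod>g\<in>F. u (s g v) g (\<omega> (s g v))) - (\<Prod>g\<in>F. \<integral>a. u (s g v) g a \<partial>Q)"
  shows "integrable (\<Pi>\<^sub>M v\<in>V. Q) (\<lambda>\<omega>. ((\<Sum>v\<in>V. D v \<omega>) / card V)\<^sup>2)" (is ?int)
    and "(\<integral>\<omega>. ((\<Sum>v\<in>V. D v \<omega>) / card V)\<^sup>2 \<partial>(\<Pi>\<^sub>M v\<in>V. Q))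
           \<le> 4 * (2 * card {v \<in> V. \<not> inj_on (\<lambda>g. s g v) F} + (card F)\<^sup>2) / card V" (is "?I \<le> _")
proof -
  interpret Q: prob_space Q by (rule Q)
  let ?P = "\<Pi>\<^sub>M v\<in>V. Q"
  interpret P: prob_space ?P by (intro prob_space_PiM Q)
  define A where "A v \<omega> = (\<Prod>g\<in>F. u (s g v) g (\<omega> (s g v)))" for v \<omega>
  define e where "e v = (\<Prod>g\<in>F. \<integral>a. u (s g v) g a \<partial>Q)" for v
  have D: "D v \<omega> = A v \<omega> - e v" for v \<omega> by (simp add: D_def A_def e_def)
  have sV: "s g v \<in> V" if "g \<in> F" "v \<in> V" for g v
    using s that permutes_in_image by metis
  have u_int: "integrable Q (u (s g v) g)" if "g \<in> F" "v \<in> V" for g v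
    using that u[OF sV] u_le[OF sV] by (intro Q.integrable_const_bound[of _ 1]) auto
  have A_meas [measurable]: "A v \<in> borel_measurable ?P" if "v \<in> V" for v
    unfolding A_def using that sV u
    by (intro borel_measurable_prod measurable_compose[OF measurable_component_singleton]) auto
  have A_le: "\<bar>A v \<omega>\<bar> \<le> 1" if "v \<in> V" "\<omega> \<in> space ?P" for v \<omega>
    unfolding A_def abs_prod
    using that sV by (intro prod_le_1) (auto intro!: u_le simp: space_PiM PiE_iff)
  have e_le: "\<bar>e v\<bar> \<le> 1" if "v \<in> V" for v
    unfolding e_def abs_prod
  proof (intro prod_le_1 conjI)
    fix g assume g: "g \<in> F"
    have "\<bar>\<integral>a. u (s g v) g a \<partial>Q\<bar> \<le> (\<integral>a. \<bar>u (s g v) g a\<bar> \<partial>Q)"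
      by (rule integral_abs_bound)
    also have "\<dots> \<le> (\<integral>a. 1 \<partial>Q)"
      using g that u_int u_le[OF sV] by (intro integral_mono) auto
    finally show "\<bar>\<integral>a. u (s g v) g a \<partial>Q\<bar> \<le> 1" by (simp add: Q.prob_space)
  qed auto
  have D_le: "\<bar>D v \<omega>\<bar> \<le> 2" if "v \<in> V" "\<omega> \<in> space ?P" for v \<omega>
    using A_le[OF that] e_le[OF that(1)] by (simp add: D)
  have D_meas [measurable]: "D v \<in> borel_measurable ?P" if "v \<in> V" for v
    using that unfolding D[abs_def] by measurable
  have DD_le: "\<bar>D v \<omega> * D v' \<omega>\<bar> \<le> 4" if "v \<in> V" "v' \<in> V" "\<omega> \<in> space ?P" for v v' \<omega>
    using mult_mono[OF D_le D_le, OF that(1,3) that(2,3)] by (simp add: abs_mult)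
  have DD_int: "integrable ?P (\<lambda>\<omega>. D v \<omega> * D v' \<omega>)" if "v \<in> V" "v' \<in> V" for v v'
    using that DD_le by (intro P.integrable_const_bound[of _ 4]) auto
  have A_int: "integrable ?P (A v)" if "v \<in> V" for v
    using that A_le by (intro P.integrable_const_bound[of _ 1]) auto
  have AA_int: "integrable ?P (\<lambda>\<omega>. A v \<omega> * A v' \<omega>)" if "v \<in> V" "v' \<in> V" for v v'
    using that mult_mono[OF A_le A_le]
    by (intro P.integrable_const_bound[of _ 1]) (auto simp: abs_mult)
  define B where "B = {v \<in> V. \<not> inj_on (\<lambda>g. s g v) F}"
  define S where "S = {(v, v') \<in> V \<times> V. v \<in> B \<or> v' \<in> B \<or> (\<exists>g\<in>F. \<exists>g'\<in>F. s g v = s g' v')}"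
  have S_V: "S \<subseteq> V \<times> V" by (auto simp: S_def)
  have uncorrelated: "(\<integral>\<omega>. D v \<omega> * D v' \<omega> \<partial>?P) = 0" if v: "v \<in> V" "v' \<in> V" "(v, v') \<notin> S" for v v'
  proof -
    have good: "inj_on (\<lambda>g. s g v) F" "inj_on (\<lambda>g. s g v') F"
      and disj: "\<And>g g'. g \<in> F \<Longrightarrow> g' \<in> F \<Longrightarrow> s g v \<noteq> s g' v'"
      using v by (auto simp: S_def B_def)
    have EA: "integral\<^sup>L ?P (A v) = e v" "integral\<^sup>L ?P (A v') = e v'"
      unfolding A_def e_def using good v sV u_int V F Q
      by (auto intro!: integral_prod_distinct_coordinates)
    \<comment> \<open>The product of the two summands is one product over the disjoint sum \<open>F <+> F\<close>.\<close>
    let ?s = "case_sum (\<lambda>g. s g v) (\<lambda>g. s g v')"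
    let ?u = "case_sum (\<lambda>g. u (s g v) g) (\<lambda>g. u (s g v') g)"
    have split: "(\<Prod>x\<in>F <+> F. f x) = (\<Prod>g\<in>F. f (Inl g)) * (\<Prod>g\<in>F. f (Inr g))"
      for f :: "'g + 'g \<Rightarrow> real"
      using F by (simp add: prod.Plus)
    have "(\<integral>\<omega>. (\<Prod>x\<in>F <+> F. ?u x (\<omega> (?s x))) \<partial>?P) = (\<Prod>x\<in>F <+> F. \<integral>a. ?u x a \<partial>Q)"
    proof (intro integral_prod_distinct_coordinates Q V)
      show "inj_on ?s (F <+> F)"
        using good disj by (fastforce simp: inj_on_def)
    qed (use v sV u_int F in auto)
    then have "(\<integral>\<omega>. A v \<omega> * A v' \<omega> \<partial>?P) = e v * e v'"
      unfolding split by (simp add: A_def e_def)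
    moreover have "(\<integral>\<omega>. D v \<omega> * D v' \<omega> \<partial>?P)
        = (\<integral>\<omega>. A v \<omega> * A v' \<omega> - e v' * A v \<omega> - e v * A v' \<omega> + e v * e v' \<partial>?P)"
      by (simp add: D algebra_simps)
    ultimately show ?thesis
      using A_int AA_int v by (simp add: EA P.prob_space)
  qed
  have square: "((\<Sum>v\<in>V. D v \<omega>) / card V)\<^sup>2 = (\<Sum>p\<in>V \<times> V. D (fst p) \<omega> * D (snd p) \<omega>) / (card V)\<^sup>2" for \<omega>
    by (simp add: power_divide power2_eq_square sum_product sum.cartesian_product case_prod_unfold)
  show ?int
    unfolding square using DD_int
    by (intro integrable_divide Bochner_Integration.integrable_sum) auto
  have "?I = (\<Sum>p\<in>V \<times> V. \<integral>\<omega>. D (fst p) \<omega> * D (snd p) \<omega> \<partial>?P) / (card V)\<^sup>2"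
    unfolding square using DD_int
    by (simp, subst Bochner_Integration.integral_sum) auto
  also have "(\<Sum>p\<in>V \<times> V. \<integral>\<omega>. D (fst p) \<omega> * D (snd p) \<omega> \<partial>?P)
      = (\<Sum>p\<in>S. \<integral>\<omega>. D (fst p) \<omega> * D (snd p) \<omega> \<partial>?P)"
    using V S_V uncorrelated by (intro sum.mono_neutral_right) auto
  also have "\<dots> \<le> (\<Sum>p\<in>S. 4)"
  proof (intro sum_mono)
    fix p assume p: "p \<in> S"
    then have p: "fst p \<in> V" "snd p \<in> V" using S_V by auto
    have "(\<integral>\<omega>. D (fst p) \<omega> * D (snd p) \<omega> \<partial>?P) \<le> (\<integral>\<omega>. 4 \<partial>?P)"
      using DD_int p DD_le[OF p] by (intro integral_mono) (auto simp: abs_le_iff)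
    then show "(\<integral>\<omega>. D (fst p) \<omega> * D (snd p) \<omega> \<partial>?P) \<le> 4" by (simp add: P.prob_space)
  qed
  also have "\<dots> = 4 * real (card S)" by simp
  also have "card S \<le> (2 * card B + (card F)\<^sup>2) * card V"
    unfolding S_def using V F s by (intro card_dependent_pairs_le) (auto simp: B_def)
  finally have "?I \<le> 4 * real ((2 * card B + (card F)\<^sup>2) * card V) / (card V)\<^sup>2"
    by (simp add: divide_right_mono)
  also have "\<dots> = 4 * (2 * card B + (card F)\<^sup>2) / card V"
    using V by (simp add: power2_eq_square)
  finally show "?I \<le> 4 * (2 * card {v \<in> V. \<not> inj_on (\<lambda>g. s g v) F} + (card F)\<^sup>2) / card V"
    unfolding B_def .
qed

text \<open>
A failure of injectivity is a coincidence \<open>\<sigma> n g v = \<sigma> n h v\<close> for one of finitely many pairs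
\<open>g \<noteq> h\<close>, and each of these is rare because the approximation is asymptotically free.
\<close>

lemma card_noninjective_vertices_tendsto_0:
  assumes "sofic_approximation G V \<sigma>" and F: "finite F" "F \<subseteq> carrier G"
  shows "(\<lambda>n. card {v \<in> V n. \<not> inj_on (\<lambda>g. \<sigma> n g v) F} / card (V n)) \<longlonglongrightarrow> 0"
proof -
  let ?N = "\<lambda>n g h. {v \<in> V n. \<sigma> n g v \<noteq> \<sigma> n h v}"
  let ?pairs = "{(g, h) \<in> F \<times> F. g \<noteq> h}"
  have fin: "finite (V n)" for n using assms(1) by (simp add: sofic_approximation_def)
  have finp: "finite ?pairs" using F(1) by (auto intro: finite_subset[of _ "F \<times> F"])
  have distinct: "(\<lambda>n. card (?N n g h) / card (V n)) \<longlonglongrightarrow> 1"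
    if "g \<in> carrier G" "h \<in> carrier G" "g \<noteq> h" for g h
    using assms(1) that unfolding sofic_approximation_def by blast
  have le: "card {v \<in> V n. \<not> inj_on (\<lambda>g. \<sigma> n g v) F} / card (V n)
      \<le> (\<Sum>(g, h)\<in>?pairs. 1 - card (?N n g h) / card (V n))" for n
  proof (cases "V n = {}")
    case True
    then show ?thesis by (simp add: sum_nonneg case_prod_unfold)
  next
    case False
    then have N: "0 < card (V n)" using fin by (simp add: card_gt_0_iff)
    have "{v \<in> V n. \<not> inj_on (\<lambda>g. \<sigma> n g v) F} \<subseteq> (\<Union>(g, h)\<in>?pairs. V n - ?N n g h)"
      by (fastforce simp: inj_on_def)
    then have "card {v \<in> V n. \<not> inj_on (\<lambda>g. \<sigma> n g v) F} \<le> card (\<Union>(g, h)\<in>?pairs. V n - ?N n g h)"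
      using fin finp by (intro card_mono) auto
    also have "\<dots> \<le> (\<Sum>p\<in>?pairs. card (case p of (g, h) \<Rightarrow> V n - ?N n g h))"
      by (rule card_UN_le[OF finp])
    finally have "card {v \<in> V n. \<not> inj_on (\<lambda>g. \<sigma> n g v) F} / card (V n)
        \<le> real (\<Sum>p\<in>?pairs. card (case p of (g, h) \<Rightarrow> V n - ?N n g h)) / card (V n)"
      by (intro divide_right_mono) (auto simp del: of_nat_sum)
    also have "\<dots> = (\<Sum>(g, h)\<in>?pairs. 1 - card (?N n g h) / card (V n))"
      unfolding of_nat_sum sum_divide_distrib
    proof (intro sum.cong refl, clarify)
      fix g h
      have "card (V n - ?N n g h) = card (V n) - card (?N n g h)" "card (?N n g h) \<le> card (V n)"
        using fin by (auto intro!: card_Diff_subset card_mono)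
      then show "real (card (V n - ?N n g h)) / card (V n) = 1 - card (?N n g h) / card (V n)"
        using N by (simp add: of_nat_diff diff_divide_distrib)
    qed
    finally show ?thesis .
  qed
  have "(\<lambda>n. \<Sum>p\<in>?pairs. 1 - card (?N n (fst p) (snd p)) / card (V n)) \<longlonglongrightarrow> (\<Sum>p\<in>?pairs. 1 - 1)"
    using F(2) by (intro tendsto_sum tendsto_diff tendsto_const distinct) auto
  then have lim: "(\<lambda>n. \<Sum>(g, h)\<in>?pairs. 1 - card (?N n g h) / card (V n)) \<longlonglongrightarrow> 0"
    by (simp add: case_prod_unfold)
  show ?thesis
    by (rule tendsto_sandwich[OF _ always_eventually[rule_format, OF le] tendsto_const lim]) simp
qed

section \<open>Replacing symbols at random\<close>

text \<open>
\<open>\<omega>\<close> assigns to every vertex a fresh symbol and a label. As \<open>k\<close> grows from 0 to the number of labels,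
the mixture moves from \<open>x\<close> to the colouring by fresh symbols, which does not depend on \<open>x\<close>.
\<close>

definition mixture :: "'v set \<Rightarrow> ('v \<Rightarrow> 'x \<times> nat) \<Rightarrow> nat \<Rightarrow> ('v \<Rightarrow> 'x) \<Rightarrow> 'v \<Rightarrow> 'x" where
  "mixture V \<omega> k x = (\<lambda>v\<in>V. if snd (\<omega> v) < k then fst (\<omega> v) else x v)"

text \<open>
The mean of the monomial \<open>\<Prod>g\<leftarrow>l. \<xi> g\<close> when each \<open>\<xi> g\<close> is independently replaced, with probability \<open>t\<close>,
by a fresh symbol of law \<open>L\<close>. Factors are collected by group element, because repeated entries of
\<open>l\<close> are replaced together.
\<close>

definition mixed_monomial :: "real measure \<Rightarrow> real \<Rightarrow> 'g list \<Rightarrow> ('g \<Rightarrow> real) \<Rightarrow> real" where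
  "mixed_monomial L t l \<xi> = (\<Prod>g\<in>set l. (1 - t) * \<xi> g ^ count_list l g + t * (\<integral>a. a ^ count_list l g \<partial>L))"

lemma mixture_in:
  assumes "x \<in> W \<rightarrow>\<^sub>E A" "\<omega> \<in> W \<rightarrow>\<^sub>E A \<times> B"
  shows "mixture W \<omega> k x \<in> W \<rightarrow>\<^sub>E A"
  using PiE_mem[OF assms(1)] PiE_mem[OF assms(2)] by (auto simp: mixture_def mem_Times_iff)

lemma mixture_0: "x \<in> W \<rightarrow>\<^sub>E A \<Longrightarrow> mixture W \<omega> 0 x = x"
  by (auto simp: mixture_def fun_eq_iff PiE_iff extensional_def)

lemma mixture_top: "\<omega> \<in> W \<rightarrow>\<^sub>E A \<times> {..<K} \<Longrightarrow> mixture W \<omega> K x = mixture W \<omega> K y"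
  using PiE_mem[of \<omega> W "\<lambda>_. A \<times> {..<K}"] by (auto simp: mixture_def fun_eq_iff mem_Times_iff)

lemma hamming_metric_commute: "hamming_metric W dist x y = hamming_metric W dist y x"
  by (simp add: hamming_metric_def dist_commute)

text \<open>
Consecutive mixtures differ only where the label is \<open>k\<close>, and symbols in \<open>{0..1}\<close> have distance at
most 1.
\<close>

lemma hamming_mixture_step:
  fixes x :: "'v \<Rightarrow> real"
  assumes W: "finite W" and "x \<in> W \<rightarrow>\<^sub>E {0..1}" "\<omega> \<in> W \<rightarrow>\<^sub>E {0..1} \<times> {..<K}"
  shows "hamming_metric W dist (mixture W \<omega> k x) (mixture W \<omega> (Suc k) x)
           \<le> card {v \<in> W. snd (\<omega> v) = k} / card W"
proof -
  have "(\<Sum>v\<in>W. dist (mixture W \<omega> k x v) (mixture W \<omega> (Suc k) x v))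
      \<le> (\<Sum>v\<in>W. if snd (\<omega> v) = k then 1 else 0)"
  proof (rule sum_mono)
    fix v assume v: "v \<in> W"
    have "fst (\<omega> v) \<in> {0..1}" "x v \<in> {0..1}"
      using assms(2,3) v by (auto dest!: PiE_mem[of _ _ _ v] simp: mem_Times_iff)
    then show "dist (mixture W \<omega> k x v) (mixture W \<omega> (Suc k) x v) \<le> (if snd (\<omega> v) = k then 1 else 0)"
      using v by (auto simp: mixture_def dist_real_def less_Suc_eq)
  qed
  also have "\<dots> = card {v \<in> W. snd (\<omega> v) = k}"
    using W by (simp add: sum.If_cases Int_def)
  finally show ?thesis
    unfolding hamming_metric_def by (rule divide_right_mono) simp
qed

lemma integrable_power_interval:
  fixes L :: "real measure"
  assumes "prob_space L" and L: "sets L = sets (restrict_space borel {0..1})"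
  shows "integrable L (\<lambda>a. a ^ m)"
proof -
  interpret prob_space L by fact
  have space: "space L = {0..1}"
    using sets_eq_imp_space_eq[OF L] by (simp add: space_restrict_space)
  have [measurable]: "(\<lambda>a. a) \<in> borel_measurable L"
    by (simp add: measurable_cong_sets[OF L refl] measurable_restrict_space1)
  show ?thesis
    by (intro integrable_const_bound[of _ 1]) (auto simp: space power_le_one)
qed

text \<open>
A union bound in expectation: a bound on the total mean makes finitely many nonnegative quantities
small at one common point.
\<close>

lemma prob_space_exists_all_less:
  fixes D :: "'j \<Rightarrow> 'a \<Rightarrow> real"
  assumes P: "prob_space P" and J: "finite J"
    and int: "\<And>j. j \<in> J \<Longrightarrow> integrable P (D j)"
    and nonneg: "\<And>j \<omega>. j \<in> J \<Longrightarrow> 0 \<le> D j \<omega>"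
    and less: "(\<Sum>j\<in>J. \<integral>\<omega>. D j \<omega> \<partial>P) < c"
  obtains \<omega> where "\<omega> \<in> space P" "\<And>j. j \<in> J \<Longrightarrow> D j \<omega> < c"
proof -
  interpret prob_space P by (rule P)
  have "\<exists>\<omega>\<in>space P. (\<Sum>j\<in>J. D j \<omega>) < c"
  proof (rule ccontr)
    assume "\<not> ?thesis"
    then have "c \<le> (\<Sum>j\<in>J. D j \<omega>)" if "\<omega> \<in> space P" for \<omega>
      using that by (auto simp: not_less)
    then have "(\<integral>\<omega>. c \<partial>P) \<le> (\<integral>\<omega>. (\<Sum>j\<in>J. D j \<omega>) \<partial>P)"
      using int by (intro integral_mono) auto
    also have "\<dots> = (\<Sum>j\<in>J. \<integral>\<omega>. D j \<omega> \<partial>P)"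
      using int by (rule Bochner_Integration.integral_sum)
    finally show False using less by (simp add: prob_space)
  qed
  then obtain \<omega> where \<omega>: "\<omega> \<in> space P" "(\<Sum>j\<in>J. D j \<omega>) < c" by blast
  have "D j \<omega> < c" if "j \<in> J" for j
    using member_le_sum[of j J "\<lambda>j. D j \<omega>"] that nonneg J \<omega>(2) by fastforce
  with \<omega>(1) that show thesis by blast
qed

text \<open>
Choose \<open>z\<close> with law \<open>L\<close> and, independently, a uniform label in \<open>{..<K}\<close>; use \<open>f z\<close> if the label lies in
\<open>S\<close>, and the given value \<open>b\<close> otherwise.
\<close>

lemma integral_switch:
  fixes f :: "'a \<Rightarrow> real" and K :: nat
  assumes L: "prob_space L" and f: "integrable L f" and S: "S \<subseteq> {..<K}" and K: "0 < K"
  shows "integrable (L \<Otimes>\<^sub>M uniform_count_measure {..<K}) (\<lambda>a. if snd a \<in> S then f (fst a) else b)" (is ?int)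
    and "(\<integral>a. (if snd a \<in> S then f (fst a) else b) \<partial>(L \<Otimes>\<^sub>M uniform_count_measure {..<K}))
          = (1 - card S / K) * b + card S / K * (\<integral>a. f a \<partial>L)"
proof -
  let ?U = "uniform_count_measure {..<K}"
  interpret L: prob_space L by (rule L)
  interpret U: prob_space ?U using K by (intro prob_space_uniform_count_measure) auto
  interpret pair_prob_space L ?U ..
  have fst_int: "integrable (L \<Otimes>\<^sub>M ?U) (\<lambda>a. f (fst a))"
    using f U.distr_pair_fst[of L] by (intro integrable_distr[OF measurable_fst]) simp
  have snd_meas: "Measurable.pred (L \<Otimes>\<^sub>M ?U) (\<lambda>a. snd a \<in> S)"
    using S by (intro measurable_compose[OF measurable_snd]) (auto simp: measurable_def)
  have f_meas [measurable]: "f \<in> borel_measurable L" using f by simp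
  show int: ?int
  proof (rule Bochner_Integration.integrable_bound)
    show "integrable (L \<Otimes>\<^sub>M ?U) (\<lambda>a. \<bar>f (fst a)\<bar> + \<bar>b\<bar>)"
      using fst_int by simp
    show "(\<lambda>a. if snd a \<in> S then f (fst a) else b) \<in> borel_measurable (L \<Otimes>\<^sub>M ?U)"
      using snd_meas by measurable
  qed auto
  have S_card: "finite S" "card ({..<K} - S) = K - card S" "card S \<le> K"
    using S card_mono[OF _ S] by (auto simp: card_Diff_subset finite_subset)
  have average: "(\<integral>w. (if w \<in> S then z else b) \<partial>?U) = (1 - card S / K) * b + card S / K * z" for z
  proof -
    have "(\<Sum>w<K. if w \<in> S then z else b) = card S * z + (K - card S) * b"
      using S S_card by (simp add: sum.If_cases Int_absorb1 Diff_eq[symmetric])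
    then show ?thesis
      using K S_card(3) by (simp add: integral_uniform_count_measure of_nat_diff field_simps)
  qed
  have "(\<integral>a. (if snd a \<in> S then f (fst a) else b) \<partial>(L \<Otimes>\<^sub>M ?U))
      = (\<integral>z. \<integral>w. (if w \<in> S then f z else b) \<partial>?U \<partial>L)"
    using integral_fst'[OF int, symmetric] by (simp only: fst_conv snd_conv)
  also have "\<dots> = (\<integral>z. (1 - card S / K) * b + card S / K * f z \<partial>L)"
    by (simp only: average)
  also have "\<dots> = (1 - card S / K) * b + card S / K * (\<integral>a. f a \<partial>L)"
    using f by (simp add: L.prob_space)
  finally show "(\<integral>a. (if snd a \<in> S then f (fst a) else b) \<partial>(L \<Otimes>\<^sub>M ?U))
      = (1 - card S / K) * b + card S / K * (\<integral>a. f a \<partial>L)" .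
qed

lemma prod_list_map_eq_prod_count:
  fixes f :: "'b \<Rightarrow> 'a :: comm_monoid_mult"
  shows "(\<Prod>g\<leftarrow>l. f g) = (\<Prod>g\<in>set l. f g ^ count_list l g)"
proof -
  have "(\<Prod>g\<leftarrow>l. f g) = (\<Prod>g\<in>A. f g ^ count_list l g)" if "finite A" "set l \<subseteq> A" for A
    using that(2)
  proof (induction l)
    case (Cons a l)
    have "(\<Prod>g\<in>A. f g ^ count_list (a # l) g) = (\<Prod>g\<in>A. (if g = a then f a else 1) * f g ^ count_list l g)"
      by (intro prod.cong) auto
    then show ?case
      using Cons that(1) by (simp add: prod.distrib)
  qed simp
  then show ?thesis by auto
qed

text \<open>
There are finitely many requirements on the random assignment \<open>\<omega>\<close>, and the second moment bound applies
to each. The mixed monomial at \<open>v\<close> is the product of the means of the factors; where the vertices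
\<open>s g v\<close> are distinct, this is the mean of the monomial over the mixture. The label counts are vertex
averages over the one-element window \<open>{e}\<close>; since \<open>s e\<close> is a permutation, counting the labels at
\<open>s e v\<close> is the same as counting them at \<open>v\<close>.
\<close>

lemma exists_typical_mixture:
  fixes L :: "real measure" and s :: "'g \<Rightarrow> 'v \<Rightarrow> 'v"
  assumes L: "prob_space L" "sets L = sets (restrict_space borel {0..1})"
    and V: "finite V" "V \<noteq> {}" and s: "\<And>g. g \<in> I \<Longrightarrow> s g permutes V"
    and K: "0 < K" and T: "finite T" "T \<subseteq> lists I" and e: "e \<in> I"
    and X: "finite X" "X \<subseteq> V \<rightarrow>\<^sub>E {0..1}" and \<eta>: "0 < \<eta>"
    and c: "\<And>F. F \<in> insert {e} (set ` T) \<Longrightarrow>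
      4 * (2 * card {v \<in> V. \<not> inj_on (\<lambda>g. s g v) F} + (card F)\<^sup>2) / card V \<le> c"
    and c_less: "real (card X * (Suc K * card T) + K) * c < \<eta>\<^sup>2"
  obtains \<omega> where "\<omega> \<in> V \<rightarrow>\<^sub>E {0..1} \<times> {..<K}"
    "\<And>x k l. x \<in> X \<Longrightarrow> k \<le> K \<Longrightarrow> l \<in> T \<Longrightarrow>
       \<bar>(\<Sum>v\<in>V. \<Prod>g\<leftarrow>l. mixture V \<omega> k x (s g v)) / card V
         - (\<Sum>v\<in>V. mixed_monomial L (k / K) l (\<lambda>g. x (s g v))) / card V\<bar> < \<eta>"
    "\<And>k. k < K \<Longrightarrow> \<bar>card {v \<in> V. snd (\<omega> v) = k} / card V - 1 / K\<bar> < \<eta>"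
proof -
  interpret L: prob_space L by (rule L)
  let ?U = "uniform_count_measure {..<K}"
  interpret U: prob_space ?U using K by (intro prob_space_uniform_count_measure) auto
  let ?Q = "L \<Otimes>\<^sub>M ?U"
  have Q: "prob_space ?Q" by (intro prob_space_pair L U.prob_space_axioms)
  let ?P = "\<Pi>\<^sub>M v\<in>V. ?Q"
  have spaceL: "space L = {0..1}"
    using sets_eq_imp_space_eq[OF L(2)] by (simp add: space_restrict_space)
  have spaceQ: "space ?Q = {0..1} \<times> {..<K}"
    by (simp add: space_pair_measure spaceL space_uniform_count_measure)
  note power_int = integrable_power_interval[OF L]
  define J :: "(('v \<Rightarrow> real) \<times> nat \<times> 'g list + nat) set" where "J = X \<times> {..K} \<times> T <+> {..<K}"
  define F :: "('v \<Rightarrow> real) \<times> nat \<times> 'g list + nat \<Rightarrow> 'g set" where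
    "F = case_sum (\<lambda>(x, k, l). set l) (\<lambda>k. {e})"
  define u :: "('v \<Rightarrow> real) \<times> nat \<times> 'g list + nat \<Rightarrow> 'v \<Rightarrow> 'g \<Rightarrow> real \<times> nat \<Rightarrow> real" where
    "u = case_sum
       (\<lambda>(x, k, l) v g a. if snd a \<in> {..<k} then fst a ^ count_list l g else x v ^ count_list l g)
       (\<lambda>k v g a. if snd a \<in> {k} then 1 else 0)"
  have F_I: "finite (F j)" "F j \<subseteq> I" "F j \<in> insert {e} (set ` T)" if "j \<in> J" for j
    using that T e by (auto simp: J_def F_def split: sum.splits)
  have sV: "s g v \<in> V" if "g \<in> I" "v \<in> V" for g v
    using s that permutes_in_image by metis
  have u_int: "integrable ?Q (u j v g)" if "j \<in> J" for j v g
    using that K integral_switch(1)[OF L(1) power_int, of "{..<k}" K for k]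
      integral_switch(1)[OF L(1), of "\<lambda>_. 1" "{k}" K for k]
    by (auto simp: J_def u_def)
  have u_meas: "u j v g \<in> borel_measurable ?Q" if "j \<in> J" for j v g
    using u_int[OF that] by (rule borel_measurable_integrable)
  have x_01: "0 \<le> x v" "x v \<le> 1" if "x \<in> X" "v \<in> V" for x v
    using that X(2) by (auto dest!: subsetD PiE_mem)
  have u_le: "\<bar>u j v g a\<bar> \<le> 1" if "j \<in> J" "v \<in> V" "a \<in> space ?Q" for j v g a
  proof -
    have "\<bar>a ^ m\<bar> \<le> 1" if "0 \<le> a" "a \<le> 1" for a :: real and m
      using that by (simp add: power_le_one)
    then show ?thesis
      using that by (auto simp: J_def u_def spaceQ x_01)
  qed
  define D where "D j v \<omega> =
    (\<Prod>g\<in>F j. u j (s g v) g (\<omega> (s g v))) - (\<Prod>g\<in>F j. \<integral>a. u j (s g v) g a \<partial>?Q)" for j v \<omega>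
  have moment: "integrable ?P (\<lambda>\<omega>. ((\<Sum>v\<in>V. D j v \<omega>) / card V)\<^sup>2)"
    "(\<integral>\<omega>. ((\<Sum>v\<in>V. D j v \<omega>) / card V)\<^sup>2 \<partial>?P) \<le> c" if j: "j \<in> J" for j
  proof -
    have *: "\<And>g. g \<in> F j \<Longrightarrow> s g permutes V" using F_I[OF j] s by auto
    show "integrable ?P (\<lambda>\<omega>. ((\<Sum>v\<in>V. D j v \<omega>) / card V)\<^sup>2)"
      unfolding D_def
      by (rule second_moment_vertex_average(1)[OF Q V F_I(1)[OF j] *]) (assumption | rule u_meas[OF j] u_le[OF j])+
    have "(\<integral>\<omega>. ((\<Sum>v\<in>V. D j v \<omega>) / card V)\<^sup>2 \<partial>?P)
        \<le> 4 * (2 * card {v \<in> V. \<not> inj_on (\<lambda>g. s g v) (F j)} + (card (F j))\<^sup>2) / card V"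
      unfolding D_def
      by (rule second_moment_vertex_average(2)[OF Q V F_I(1)[OF j] *]) (assumption | rule u_meas[OF j] u_le[OF j])+
    also have "\<dots> \<le> c" using c[OF F_I(3)[OF j]] by simp
    finally show "(\<integral>\<omega>. ((\<Sum>v\<in>V. D j v \<omega>) / card V)\<^sup>2 \<partial>?P) \<le> c" .
  qed
  have finJ: "finite J" using X T by (simp add: J_def)
  have "(\<Sum>j\<in>J. \<integral>\<omega>. ((\<Sum>v\<in>V. D j v \<omega>) / card V)\<^sup>2 \<partial>?P) \<le> (\<Sum>j\<in>J. c)"
    using moment(2) by (rule sum_mono)
  also have "\<dots> = real (card X * (Suc K * card T) + K) * c"
    using X T by (simp add: J_def card_Plus card_cartesian_product)
  finally have sum_less: "(\<Sum>j\<in>J. \<integral>\<omega>. ((\<Sum>v\<in>V. D j v \<omega>) / card V)\<^sup>2 \<partial>?P) < \<eta>\<^sup>2"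
    using c_less by simp
  have "prob_space ?P" by (intro prob_space_PiM Q)
  from prob_space_exists_all_less[OF this finJ moment(1) _ sum_less]
  obtain \<omega> where \<omega>: "\<omega> \<in> space ?P" "\<And>j. j \<in> J \<Longrightarrow> ((\<Sum>v\<in>V. D j v \<omega>) / card V)\<^sup>2 < \<eta>\<^sup>2"
    by auto
  have small: "\<bar>(\<Sum>v\<in>V. D j v \<omega>) / card V\<bar> < \<eta>" if "j \<in> J" for j
    using \<omega>(2)[OF that] \<eta> by (intro power2_less_imp_less[of _ \<eta>]) (auto simp: abs_if)
  show thesis
  proof (rule that[of \<omega>])
    show "\<omega> \<in> V \<rightarrow>\<^sub>E {0..1} \<times> {..<K}" using \<omega>(1) by (simp add: space_PiM spaceQ)
  next
    fix x k l assume xkl: "x \<in> X" "k \<le> K" "l \<in> T"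
    let ?j = "Inl (x, k, l) :: ('v \<Rightarrow> real) \<times> nat \<times> 'g list + nat"
    have j: "?j \<in> J" using xkl by (auto simp: J_def)
    have "D ?j v \<omega> = (\<Prod>g\<leftarrow>l. mixture V \<omega> k x (s g v)) - mixed_monomial L (k / K) l (\<lambda>g. x (s g v))"
      if v: "v \<in> V" for v
    proof -
      have l: "set l \<subseteq> I" using T(2) xkl by auto
      have "(\<Prod>g\<leftarrow>l. mixture V \<omega> k x (s g v)) = (\<Prod>g\<in>F ?j. u ?j (s g v) g (\<omega> (s g v)))"
        unfolding prod_list_map_eq_prod_count F_def u_def mixture_def
        using l v sV by (auto intro!: prod.cong)
      moreover have "mixed_monomial L (k / K) l (\<lambda>g. x (s g v)) = (\<Prod>g\<in>F ?j. \<integral>a. u ?j (s g v) g a \<partial>?Q)"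
        using integral_switch(2)[OF L(1) power_int, of "{..<k}" K] K xkl
        unfolding mixed_monomial_def F_def u_def by simp
      ultimately show ?thesis by (simp add: D_def)
    qed
    then have "(\<Sum>v\<in>V. D ?j v \<omega>) / card V = (\<Sum>v\<in>V. \<Prod>g\<leftarrow>l. mixture V \<omega> k x (s g v)) / card V
         - (\<Sum>v\<in>V. mixed_monomial L (k / K) l (\<lambda>g. x (s g v))) / card V"
      by (simp add: sum_subtractf diff_divide_distrib)
    with small[OF j] show "\<bar>(\<Sum>v\<in>V. \<Prod>g\<leftarrow>l. mixture V \<omega> k x (s g v)) / card V
         - (\<Sum>v\<in>V. mixed_monomial L (k / K) l (\<lambda>g. x (s g v))) / card V\<bar> < \<eta>"
      by simp
  next
    fix k assume k: "k < K"
    let ?j = "Inr k :: ('v \<Rightarrow> real) \<times> nat \<times> 'g list + nat"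
    have j: "?j \<in> J" using k by (auto simp: J_def)
    have "D ?j v \<omega> = (if snd (\<omega> (s e v)) = k then 1 else 0) - 1 / K" for v
      using integral_switch(2)[OF L(1), of "\<lambda>_. 1" "{k}" K 0] K k
      by (simp add: D_def F_def u_def L.prob_space)
    then have "(\<Sum>v\<in>V. D ?j v \<omega>) = (\<Sum>v\<in>V. (if snd (\<omega> (s e v)) = k then 1 else 0)) - card V / K"
      by (simp add: sum_subtractf)
    also have "(\<Sum>v\<in>V. (if snd (\<omega> (s e v)) = k then 1 else 0 :: real)) = (\<Sum>v\<in>V. (if snd (\<omega> v) = k then 1 else 0))"
      using sum.permute[OF s[OF e], of "\<lambda>v. if snd (\<omega> v) = k then 1 else 0 :: real"] by (simp add: comp_def)
    also have "\<dots> = card {v \<in> V. snd (\<omega> v) = k}"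
      using V(1) by (simp add: sum.If_cases Int_def)
    finally have "(\<Sum>v\<in>V. D ?j v \<omega>) / card V = card {v \<in> V. snd (\<omega> v) = k} / card V - 1 / K"
      using V by (simp add: diff_divide_distrib)
    with small[OF j] show "\<bar>card {v \<in> V. snd (\<omega> v) = k} / card V - 1 / K\<bar> < \<eta>" by simp
  qed
qed

section \<open>Polynomials as test functions for the weak-star topology\<close>

lemma limitin_weak_star_integral:
  assumes lim: "limitin (weak_star_topology T N) P \<mu> F" and f: "continuous_map T euclideanreal f"
  shows "((\<lambda>i. \<integral>x. f x \<partial>P i) \<longlongrightarrow> (\<integral>x. f x \<partial>\<mu>)) F"
proof (rule topological_tendstoI)
  fix U assume U: "open U" "(\<integral>x. f x \<partial>\<mu>) \<in> U"
  let ?W = "{\<mu> \<in> space (prob_algebra N). (\<integral>x. f x \<partial>\<mu>) \<in> U}"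
  have "openin (weak_star_topology T N) ?W"
    unfolding weak_star_topology_def using U f by (intro topology_generated_by_Basis) blast
  moreover have "\<mu> \<in> space (prob_algebra N)"
    using limitin_topspace[OF lim] unfolding weak_star_topology_def by auto
  ultimately have "\<forall>\<^sub>F i in F. P i \<in> ?W"
    using lim U unfolding limitin_def by blast
  then show "\<forall>\<^sub>F i in F. (\<integral>x. f x \<partial>P i) \<in> U" by eventually_elim simp
qed

text \<open>
The linear span of the monomials in the coordinates of \<open>I\<close>. Generating by scalar multiples of
monomials and by sums, rather than by ring operations, gives the induction principle needed below:
a property that is linear in the integrand has to be checked on monomials only.
\<close>

inductive_set polynomials :: "'g set \<Rightarrow> (('g \<Rightarrow> real) \<Rightarrow> real) set" for I where
  monomial: "l \<in> lists I \<Longrightarrow> (\<lambda>\<xi>. c * (\<Prod>g\<leftarrow>l. \<xi> g)) \<in> polynomials I"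
| add: "p \<in> polynomials I \<Longrightarrow> q \<in> polynomials I \<Longrightarrow> (\<lambda>\<xi>. p \<xi> + q \<xi>) \<in> polynomials I"

lemma polynomials_mult:
  assumes "p \<in> polynomials I" "q \<in> polynomials I"
  shows "(\<lambda>\<xi>. p \<xi> * q \<xi>) \<in> polynomials I"
  using assms(1)
proof induction
  case (monomial l c)
  show ?case using assms(2)
  proof induction
    case (monomial l' c')
    have "(\<lambda>\<xi>. (c * c') * (\<Prod>g\<leftarrow>l @ l'. \<xi> g)) \<in> polynomials I"
      using \<open>l \<in> lists I\<close> monomial by (intro polynomials.monomial) auto
    then show ?case by (simp add: mult_ac)
  next
    case (add p q)
    then show ?case by (simp add: distrib_left polynomials.add)
  qed
next
  case (add p p')
  then show ?case by (simp add: distrib_right polynomials.add)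
qed

lemma polynomials_reindex:
  assumes "p \<in> polynomials UNIV" "range \<gamma> \<subseteq> I"
  shows "(\<lambda>\<xi>. p (\<lambda>n. \<xi> (\<gamma> n))) \<in> polynomials I"
  using assms(1)
proof induction
  case (monomial l c)
  have "(\<lambda>\<xi>. c * (\<Prod>g\<leftarrow>map \<gamma> l. \<xi> g)) \<in> polynomials I"
    using assms(2) by (intro polynomials.monomial) (auto simp: image_subset_iff)
  then show ?case by (simp add: comp_def)
qed (rule polynomials.add)

lemma continuous_on_prod_list_coordinates:
  "continuous_on S (\<lambda>\<xi> :: 'g \<Rightarrow> real. (\<Prod>g\<leftarrow>l. \<xi> g))"
  by (induction l)
     (auto intro!: continuous_on_mult intro: continuous_on_subset[OF continuous_on_product_coordinates])

lemma compact_cube: "compact (Pi\<^sub>E UNIV (\<lambda>_. {0..1}) :: (nat \<Rightarrow> real) set)"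
proof -
  have "compactin (product_topology (\<lambda>_. euclidean) UNIV) (Pi\<^sub>E UNIV (\<lambda>_. {0..1}) :: (nat \<Rightarrow> real) set)"
    by (simp add: compactin_PiE)
  then show ?thesis
    unfolding euclidean_product_topology by (simp del: compactin_PiE)
qed

lemma function_ring_on_polynomials:
  "function_ring_on (polynomials UNIV) (Pi\<^sub>E UNIV (\<lambda>_. {0..1}) :: (nat \<Rightarrow> real) set)"
proof
  fix p :: "(nat \<Rightarrow> real) \<Rightarrow> real"
  assume "p \<in> polynomials UNIV"
  then show "continuous_on (Pi\<^sub>E UNIV (\<lambda>_. {0..1})) p"
    by induction (auto intro!: continuous_intros continuous_on_prod_list_coordinates)
next
  show "(\<lambda>_. c) \<in> polynomials UNIV" for c :: real
    using polynomials.monomial[of "[]" UNIV c] by simp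
next
  fix x y :: "nat \<Rightarrow> real"
  assume "x \<noteq> y"
  then obtain n where "x n \<noteq> y n" by auto
  then show "\<exists>f\<in>polynomials UNIV. f x \<noteq> f y"
    using polynomials.monomial[of "[n]" UNIV 1] by (intro bexI[of _ "\<lambda>\<xi>. \<xi> n"]) auto
qed (auto intro: polynomials.add polynomials_mult compact_cube)

text \<open>
The Stone--Weierstrass theorem on the cube with coordinates in a countable set \<open>I\<close>. It is carried
over from the cube indexed by the natural numbers along an enumeration of \<open>I\<close>, which may repeat
elements when \<open>I\<close> is finite; points of the cube over \<open>I\<close> are recovered through \<open>to_nat_on I\<close>. On
\<open>nat \<Rightarrow> real\<close> the product topology is metrizable, which supplies the Hausdorff property.
\<close>

lemma polynomials_dense:
  fixes f :: "('g \<Rightarrow> real) \<Rightarrow> real"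
  assumes I: "countable I" "I \<noteq> {}"
    and f: "continuous_map (product_topology (\<lambda>_. top_of_set {0..1}) I) euclideanreal f"
    and \<epsilon>: "0 < \<epsilon>"
  obtains p where "p \<in> polynomials I" "\<And>\<xi>. \<xi> \<in> I \<rightarrow>\<^sub>E {0..1} \<Longrightarrow> \<bar>f \<xi> - p \<xi>\<bar> < \<epsilon>"
proof -
  let ?S = "Pi\<^sub>E UNIV (\<lambda>_. {0..1}) :: (nat \<Rightarrow> real) set"
  let ?r = "\<lambda>\<zeta>. \<lambda>g\<in>I. \<zeta> (to_nat_on I g) :: real"
  have "continuous_map (top_of_set ?S) (product_topology (\<lambda>_. top_of_set {0..1}) I) ?r"
    unfolding continuous_map_componentwise
  proof (intro conjI ballI)
    fix g assume "g \<in> I"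
    have "continuous_on ?S (\<lambda>\<zeta>. \<zeta> (to_nat_on I g))"
      by (rule continuous_on_subset[OF continuous_on_product_coordinates]) simp
    then show "continuous_map (top_of_set ?S) (top_of_set {0..1}) (\<lambda>\<zeta>. ?r \<zeta> g)"
      using \<open>g \<in> I\<close> by (simp add: continuous_map_in_subtopology image_subset_iff PiE_iff)
  qed auto
  then have "continuous_map (top_of_set ?S) euclideanreal (f \<circ> ?r)"
    using f by (rule continuous_map_compose)
  then have "continuous_on ?S (f \<circ> ?r)" by simp
  from function_ring_on.Stone_Weierstrass_basic[OF function_ring_on_polynomials this \<epsilon>]
  obtain p where p: "p \<in> polynomials UNIV" "\<And>\<zeta>. \<zeta> \<in> ?S \<Longrightarrow> \<bar>f (?r \<zeta>) - p \<zeta>\<bar> < \<epsilon>"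
    unfolding comp_def by blast
  have into: "from_nat_into I n \<in> I" for n
    using I by (simp add: from_nat_into)
  show thesis
  proof
    show "(\<lambda>\<xi>. p (\<lambda>n. \<xi> (from_nat_into I n))) \<in> polynomials I"
      using polynomials_reindex[OF p(1), of "from_nat_into I" I] into by auto
    fix \<xi> :: "'g \<Rightarrow> real" assume \<xi>: "\<xi> \<in> I \<rightarrow>\<^sub>E {0..1}"
    have retract: "?r (\<lambda>n. \<xi> (from_nat_into I n)) = \<xi>"
      using \<xi> I by (auto simp: fun_eq_iff PiE_iff extensional_def)
    have "(\<lambda>n. \<xi> (from_nat_into I n)) \<in> ?S"
      using \<xi> into by (auto simp: PiE_iff)
    from p(2)[OF this] show "\<bar>f \<xi> - p (\<lambda>n. \<xi> (from_nat_into I n))\<bar> < \<epsilon>"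
      by (simp only: retract)
  qed
qed

lemma polynomials_measurable:
  fixes L :: "real measure"
  assumes "p \<in> polynomials I" "sets L = sets (restrict_space borel {0..1})"
  shows "p \<in> borel_measurable (Pi\<^sub>M I (\<lambda>_. L))"
  using assms(1)
proof induction
  case (monomial l c)
  have coord: "(\<lambda>\<xi>. \<xi> g) \<in> borel_measurable (Pi\<^sub>M I (\<lambda>_. L))" if "g \<in> I" for g
  proof -
    have "(\<lambda>a. a) \<in> L \<rightarrow>\<^sub>M (borel :: real measure)"
      by (simp add: measurable_cong_sets[OF assms(2) refl] measurable_restrict_space1)
    then show ?thesis
      using measurable_component_singleton[OF that] by (rule measurable_compose[rotated])
  qed
  from monomial have "(\<lambda>\<xi>. \<Prod>g\<leftarrow>l. \<xi> g) \<in> borel_measurable (Pi\<^sub>M I (\<lambda>_. L))"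
    by (induction l) (auto intro!: borel_measurable_times coord)
  then show ?case by simp
qed auto

text \<open>
Continuous functions are uniform limits of polynomials, so they are measurable for the product
\<open>\<sigma>\<close>-algebra.
\<close>

lemma continuous_measurable:
  fixes f :: "('g \<Rightarrow> real) \<Rightarrow> real" and L :: "real measure"
  assumes L: "sets L = sets (restrict_space borel {0..1})" and I: "countable I" "I \<noteq> {}"
    and f: "continuous_map (product_topology (\<lambda>_. top_of_set {0..1}) I) euclideanreal f"
  shows "f \<in> borel_measurable (Pi\<^sub>M I (\<lambda>_. L))"
proof -
  have "space L = {0..1}"
    using sets_eq_imp_space_eq[OF L] by (simp add: space_restrict_space)
  have "\<exists>p. p \<in> polynomials I \<and> (\<forall>\<xi>\<in>I \<rightarrow>\<^sub>E {0..1}. \<bar>f \<xi> - p \<xi>\<bar> < 1 / Suc n)" for n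
    using polynomials_dense[OF I f, of "1 / Suc n"] by (metis divide_pos_pos of_nat_0_less_iff zero_less_Suc zero_less_one)
  then obtain p where p: "\<And>n. p n \<in> polynomials I"
    "\<And>n \<xi>. \<xi> \<in> I \<rightarrow>\<^sub>E {0..1} \<Longrightarrow> \<bar>f \<xi> - p n \<xi>\<bar> < 1 / Suc n"
    by metis
  show ?thesis
  proof (rule borel_measurable_LIMSEQ_metric)
    show "p n \<in> borel_measurable (Pi\<^sub>M I (\<lambda>_. L))" for n
      using p(1) L by (rule polynomials_measurable)
    fix \<xi> assume "\<xi> \<in> space (Pi\<^sub>M I (\<lambda>_. L))"
    then have \<xi>: "\<xi> \<in> I \<rightarrow>\<^sub>E {0..1}" by (simp add: space_PiM \<open>space L = _\<close>)
    show "(\<lambda>n. p n \<xi>) \<longlonglongrightarrow> f \<xi>"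
    proof (rule LIMSEQ_I)
      fix r :: real assume "0 < r"
      then obtain N where "1 / Suc N < r" using nat_approx_posE by blast
      then have "norm (p n \<xi> - f \<xi>) < r" if "N \<le> n" for n
        using p(2)[OF \<xi>, of n] that
        by (smt (verit) frac_le of_nat_0_less_iff of_nat_mono Suc_le_mono real_norm_def zero_less_Suc)
      then show "\<exists>N. \<forall>n\<ge>N. norm (p n \<xi> - f \<xi>) < r" by blast
    qed
  qed
qed

text \<open>
Uniform convergence of the integrals of monomials along a family of sets of measures passes to
polynomials by linearity, to continuous functions by uniform approximation, and then to arbitrary
weak\<open>\<^sup>*\<close> neighbourhoods through the subbase that generates the topology.
\<close>

lemma eventually_in_weak_star_nbhd:
  fixes \<P> :: "'i \<Rightarrow> ('g \<Rightarrow> real) measure set" and \<mu> :: "('g \<Rightarrow> real) measure"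
  assumes L: "sets L = sets (restrict_space borel {0..1})" and I: "countable I" "I \<noteq> {}"
    and prob: "\<And>i P. P \<in> \<P> i \<Longrightarrow> P \<in> space (prob_algebra (Pi\<^sub>M I (\<lambda>_. L)))"
      "\<mu> \<in> space (prob_algebra (Pi\<^sub>M I (\<lambda>_. L)))"
    and mono: "\<And>l \<epsilon>. l \<in> lists I \<Longrightarrow> 0 < \<epsilon> \<Longrightarrow>
      \<forall>\<^sub>F i in F. \<forall>P\<in>\<P> i. \<bar>(\<integral>\<xi>. (\<Prod>g\<leftarrow>l. \<xi> g) \<partial>P) - (\<integral>\<xi>. (\<Prod>g\<leftarrow>l. \<xi> g) \<partial>\<mu>)\<bar> < \<epsilon>"
    and U: "openin (weak_star_topology (product_topology (\<lambda>_. top_of_set {0..1}) I) (Pi\<^sub>M I (\<lambda>_. L))) U"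
      "\<mu> \<in> U"
  shows "\<forall>\<^sub>F i in F. \<P> i \<subseteq> U"
proof -
  let ?N = "Pi\<^sub>M I (\<lambda>_. L)"
  let ?T = "product_topology (\<lambda>_. top_of_set {0..1}) I :: ('g \<Rightarrow> real) topology"
  have spaceL: "space L = {0..1}"
    using sets_eq_imp_space_eq[OF L] by (simp add: space_restrict_space)
  have space_P: "space P = I \<rightarrow>\<^sub>E {0..1}" "prob_space P" "sets P = sets ?N"
    if "P \<in> space (prob_algebra ?N)" for P
    using that sets_eq_imp_space_eq[of P ?N] by (auto simp: space_prob_algebra space_PiM spaceL)
  have int_cont: "integrable P f" if P: "P \<in> space (prob_algebra ?N)" and f: "continuous_map ?T euclideanreal f" for P f
  proof -
    interpret prob_space P by (rule space_P(2)[OF P])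
    have "compact_space ?T" by (simp add: compact_space_product_topology compact_space_subtopology)
    then have "compact (f ` topspace ?T)"
      using image_compactin[OF _ f] by (simp add: compact_space_def)
    then obtain c where "\<And>\<xi>. \<xi> \<in> topspace ?T \<Longrightarrow> \<bar>f \<xi>\<bar> \<le> c"
      by (force dest!: compact_imp_bounded simp: bounded_iff)
    then show ?thesis
      using continuous_measurable[OF L I f] space_P[OF P]
      by (intro integrable_const_bound[of _ c]) (auto cong: measurable_cong_sets)
  qed
  have coord: "continuous_map ?T euclideanreal (\<lambda>\<xi>. \<xi> g)" if "g \<in> I" for g
    using continuous_map_product_projection[of g I "\<lambda>_. top_of_set {0..1::real}"] that
    by (simp add: continuous_map_in_subtopology)
  have cont_mono: "continuous_map ?T euclideanreal (\<lambda>\<xi>. \<Prod>g\<leftarrow>l. \<xi> g)" if "l \<in> lists I" for l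
    using that
  proof (induction l)
    case (Cons g l)
    then show ?case
      by (auto intro!: continuous_map_real_mult coord)
  qed auto
  have cont_poly: "continuous_map ?T euclideanreal p" if "p \<in> polynomials I" for p
    using that by induction (auto intro!: continuous_map_real_mult continuous_map_add cont_mono)
  have poly: "\<forall>\<^sub>F i in F. \<forall>P\<in>\<P> i. \<bar>(\<integral>\<xi>. p \<xi> \<partial>P) - (\<integral>\<xi>. p \<xi> \<partial>\<mu>)\<bar> < \<epsilon>"
    if "p \<in> polynomials I" "0 < \<epsilon>" for p \<epsilon>
    using that
  proof (induction arbitrary: \<epsilon>)
    case (monomial l c)
    have "0 < \<epsilon> / (\<bar>c\<bar> + 1)" using monomial by simp
    from mono[OF monomial(1) this] show ?case
    proof eventually_elim
      case (elim i)
      show ?case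
      proof
        fix P assume "P \<in> \<P> i"
        with elim have *: "\<bar>(\<integral>\<xi>. (\<Prod>g\<leftarrow>l. \<xi> g) \<partial>P) - (\<integral>\<xi>. (\<Prod>g\<leftarrow>l. \<xi> g) \<partial>\<mu>)\<bar> < \<epsilon> / (\<bar>c\<bar> + 1)" by auto
        have "\<bar>c\<bar> * \<bar>(\<integral>\<xi>. (\<Prod>g\<leftarrow>l. \<xi> g) \<partial>P) - (\<integral>\<xi>. (\<Prod>g\<leftarrow>l. \<xi> g) \<partial>\<mu>)\<bar> \<le> \<bar>c\<bar> * (\<epsilon> / (\<bar>c\<bar> + 1))"
          using * by (intro mult_left_mono) auto
        also have "\<dots> < \<epsilon>" using monomial(2) by (simp add: field_simps)
        finally show "\<bar>(\<integral>\<xi>. c * (\<Prod>g\<leftarrow>l. \<xi> g) \<partial>P) - (\<integral>\<xi>. c * (\<Prod>g\<leftarrow>l. \<xi> g) \<partial>\<mu>)\<bar> < \<epsilon>"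
          by (simp add: abs_mult[symmetric] right_diff_distrib)
      qed
    qed
  next
    case (add p q)
    then have e: "0 < \<epsilon> / 2" by simp
    show ?case using add(3)[OF e] add(4)[OF e]
    proof eventually_elim
      case (elim i)
      show ?case
      proof
        fix P assume P: "P \<in> \<P> i"
        have int: "integrable Q p" "integrable Q q" if "Q \<in> {P, \<mu>}" for Q
          using that prob(1)[OF P] prob(2) add(1,2) by (auto intro!: int_cont cont_poly)
        show "\<bar>(\<integral>\<xi>. p \<xi> + q \<xi> \<partial>P) - (\<integral>\<xi>. p \<xi> + q \<xi> \<partial>\<mu>)\<bar> < \<epsilon>"
          using elim P int by (simp add: abs_if) (smt (verit) field_sum_of_halves)
      qed
    qed
  qed
  have cont: "\<forall>\<^sub>F i in F. \<forall>P\<in>\<P> i. \<bar>(\<integral>\<xi>. f \<xi> \<partial>P) - (\<integral>\<xi>. f \<xi> \<partial>\<mu>)\<bar> < \<epsilon>"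
    if f: "continuous_map ?T euclideanreal f" and \<epsilon>: "0 < \<epsilon>" for f \<epsilon>
  proof -
    have e: "0 < \<epsilon> / 3" using \<epsilon> by simp
    obtain p where p: "p \<in> polynomials I" "\<And>\<xi>. \<xi> \<in> I \<rightarrow>\<^sub>E {0..1} \<Longrightarrow> \<bar>f \<xi> - p \<xi>\<bar> < \<epsilon> / 3"
      using polynomials_dense[OF I f e] by blast
    have near: "\<bar>(\<integral>\<xi>. f \<xi> \<partial>P) - (\<integral>\<xi>. p \<xi> \<partial>P)\<bar> \<le> \<epsilon> / 3"
      if P: "P \<in> space (prob_algebra ?N)" for P
    proof -
      interpret prob_space P by (rule space_P(2)[OF P])
      have int: "integrable P f" "integrable P p"
        using int_cont[OF P] f cont_poly[OF p(1)] by auto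
      have "\<bar>(\<integral>\<xi>. f \<xi> \<partial>P) - (\<integral>\<xi>. p \<xi> \<partial>P)\<bar> = \<bar>\<integral>\<xi>. f \<xi> - p \<xi> \<partial>P\<bar>"
        using int by simp
      also have "\<dots> \<le> (\<integral>\<xi>. \<bar>f \<xi> - p \<xi>\<bar> \<partial>P)" by (rule integral_abs_bound)
      also have "\<dots> \<le> (\<integral>\<xi>. \<epsilon> / 3 \<partial>P)"
        using int p(2) space_P(1)[OF P] by (intro integral_mono) (auto intro: less_imp_le)
      finally show ?thesis by (simp add: prob_space)
    qed
    show ?thesis using poly[OF p(1) e]
    proof eventually_elim
      case (elim i)
      show ?case
      proof
        fix P assume P: "P \<in> \<P> i"
        from elim P have "\<bar>(\<integral>\<xi>. p \<xi> \<partial>P) - (\<integral>\<xi>. p \<xi> \<partial>\<mu>)\<bar> < \<epsilon> / 3" by blast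
        with near[OF prob(1)[OF P]] near[OF prob(2)]
        show "\<bar>(\<integral>\<xi>. f \<xi> \<partial>P) - (\<integral>\<xi>. f \<xi> \<partial>\<mu>)\<bar> < \<epsilon>" by linarith
      qed
    qed
  qed
  \<comment> \<open>The sets \<open>U\<close> for which the claim holds are closed under finite intersections and unions.\<close>
  from U(1) have "generate_topology_on {{\<mu> \<in> space (prob_algebra ?N). (\<integral>x. f x \<partial>\<mu>) \<in> U} | f U.
          continuous_map ?T euclideanreal f \<and> open U} U"
    unfolding weak_star_topology_def by (rule openin_topology_generated_by)
  then show ?thesis using U(2)
  proof induction
    case (Int a b)
    then show ?case by (auto simp: eventually_conj_iff)
  next
    case (UN K)
    then obtain k where k: "k \<in> K" "\<mu> \<in> k" by auto
    have "\<forall>\<^sub>F i in F. \<P> i \<subseteq> k" using UN k by blast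
    then show ?case by eventually_elim (use k in auto)
  next
    case (Basis s)
    then obtain f W where s: "s = {\<mu> \<in> space (prob_algebra ?N). (\<integral>x. f x \<partial>\<mu>) \<in> W}"
      and f: "continuous_map ?T euclideanreal f" and W: "open W" by auto
    have "(\<integral>x. f x \<partial>\<mu>) \<in> W" using Basis s by auto
    then obtain \<epsilon> where \<epsilon>: "0 < \<epsilon>" "\<And>y. \<bar>y - (\<integral>x. f x \<partial>\<mu>)\<bar> < \<epsilon> \<Longrightarrow> y \<in> W"
      using W by (force simp: open_dist dist_real_def)
    show ?case using cont[OF f \<epsilon>(1)]
      by eventually_elim (auto simp: s prob(1) \<epsilon>(2))
  qed auto
qed

section \<open>Standard Borel spaces\<close>

text \<open>
Digits in base 4 that are only 0 and 1 can be read off from the sum, because the tail of such an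
expansion is at most \<open>1 / 3\<close>; carries cannot occur.
\<close>

lemma floor_mod_digit:
  fixes b :: "nat \<Rightarrow> bool"
  shows "\<lfloor>4 ^ Suc j * (\<Sum>i. of_bool (b i) * (1 / 4 :: real) ^ Suc i)\<rfloor> mod 4 = of_bool (b j)"
proof -
  let ?t = "\<lambda>i. of_bool (b i) * (1 / 4 :: real) ^ Suc i"
  have geo: "(\<lambda>i. (1 / 4 :: real) ^ Suc i) sums (1 / 3)"
    using sums_mult[OF geometric_sums[of "1 / 4 :: real"], of "1 / 4"] by simp
  have sum_tail: "summable (\<lambda>i. of_bool (c i) * (1 / 4 :: real) ^ Suc i)"
    and tail: "0 \<le> (\<Sum>i. of_bool (c i) * (1 / 4 :: real) ^ Suc i)"
      "(\<Sum>i. of_bool (c i) * (1 / 4 :: real) ^ Suc i) \<le> 1 / 3" for c :: "nat \<Rightarrow> bool"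
  proof -
    show *: "summable (\<lambda>i. of_bool (c i) * (1 / 4 :: real) ^ Suc i)"
      by (rule summable_comparison_test'[OF sums_summable[OF geo], of 0]) simp
    show "0 \<le> (\<Sum>i. of_bool (c i) * (1 / 4 :: real) ^ Suc i)"
      using * by (intro suminf_nonneg) auto
    show "(\<Sum>i. of_bool (c i) * (1 / 4 :: real) ^ Suc i) \<le> 1 / 3"
      using suminf_le[OF _ * sums_summable[OF geo]] sums_unique[OF geo] by simp
  qed
  define A :: int where "A = (\<Sum>i<j. of_bool (b i) * 4 ^ (j - i))"
  define r where "r = (\<Sum>i. of_bool (b (i + Suc j)) * (1 / 4 :: real) ^ Suc i)"
  have "4 ^ Suc j * (\<Sum>i. ?t i) = 4 ^ Suc j * (\<Sum>i<Suc j. ?t i) + 4 ^ Suc j * (\<Sum>i. ?t (i + Suc j))"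
    using suminf_split_initial_segment[OF sum_tail, of b "Suc j"] by (simp add: distrib_left)
  also have "4 ^ Suc j * (\<Sum>i. ?t (i + Suc j)) = (\<Sum>i. 4 ^ Suc j * ?t (i + Suc j))"
    using summable_ignore_initial_segment[OF sum_tail] by (rule suminf_mult[symmetric])
  also have "\<dots> = r"
    unfolding r_def by (intro suminf_cong) (simp add: power_add power_divide)
  also have "4 ^ Suc j * (\<Sum>i<Suc j. ?t i) = (\<Sum>i<Suc j. of_bool (b i) * 4 ^ (j - i))"
    unfolding sum_distrib_left
    by (intro sum.cong refl) (simp add: power_diff power_divide)
  also have "\<dots> = of_int (A + of_bool (b j))"
    by (simp add: A_def)
  finally have "\<lfloor>4 ^ Suc j * (\<Sum>i. ?t i)\<rfloor> = A + of_bool (b j)"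
    using tail[of "\<lambda>i. b (i + Suc j)", folded r_def] by (simp add: floor_eq_iff)
  moreover have "4 dvd A"
    unfolding A_def by (intro dvd_sum dvd_mult) (simp add: dvd_power)
  ultimately show ?thesis by (auto simp: mod_add_eq[symmetric])
qed

text \<open>
The point \<open>x\<close> is encoded by
the digits telling which balls \<open>mball (a i) (1 / 2 ^ k)\<close> around a dense sequence contain \<open>x\<close>.
Decoding picks, for each \<open>k\<close>, the first such ball and passes to the limit of the centres. Requiring
the centres to be consistent makes the decoder total: consistent centres form a Cauchy
sequence, so completeness provides the limit.
\<close>

lemma standard_borel_retract_of_interval:
  assumes std: "standard_borel \<nu>" and ne: "space \<nu> \<noteq> {}"
  obtains f g where "f \<in> \<nu> \<rightarrow>\<^sub>M restrict_space borel {0..1::real}"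
    "g \<in> restrict_space borel {0..1::real} \<rightarrow>\<^sub>M \<nu>" "\<And>x. x \<in> space \<nu> \<Longrightarrow> g (f x) = x"
proof -
  from std obtain T where T: "topspace T = space \<nu>" "completely_metrizable_space T" "second_countable T"
    "sets \<nu> = sigma_sets (space \<nu>) {U. openin T U}"
    unfolding standard_borel_def by blast
  obtain M d where Md: "Metric_space M d" "Metric_space.mcomplete M d" "T = Metric_space.mtopology M d"
    using T(2) unfolding completely_metrizable_space_def by blast
  interpret Metric_space M d by (rule Md(1))
  have M: "M = space \<nu>" using T(1) Md(3) by simp
  have open_sets: "U \<in> sets \<nu>" if "openin mtopology U" for U
    unfolding T(4) using that Md(3) by auto
  obtain C where C: "countable C" "C \<subseteq> M" "mtopology closure_of C = M"
    using second_countable_imp_separable_space[OF T(3)] unfolding separable_space_def Md(3) by auto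
  have "C \<noteq> {}" using C(3) M ne by auto
  define a where "a = from_nat_into C"
  have a_M: "a i \<in> M" for i
    using from_nat_into[OF \<open>C \<noteq> {}\<close>] C(2) by (auto simp: a_def)
  have dense: "\<exists>i. d (a i) x < r" if x: "x \<in> M" and r: "0 < r" for x r
  proof -
    have "x \<in> mtopology closure_of C" using x C(3) by simp
    then have "\<exists>y\<in>C. y \<in> mball x r"
      using r unfolding metric_closure_of by simp
    then obtain y where "y \<in> C" "y \<in> mball x r" by blast
    moreover obtain i where "y = a i"
      using from_nat_into_surj[OF C(1) \<open>y \<in> C\<close>] by (auto simp: a_def)
    ultimately show ?thesis by (auto simp: commute)
  qed
  define \<rho> where "\<rho> k = (1 / 2 :: real) ^ k" for k :: nat
  have \<rho>: "0 < \<rho> k" for k by (simp add: \<rho>_def)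
  have \<rho>_small: "\<exists>k. \<rho> k < e" if "0 < e" for e
    using real_arch_pow_inv[OF that, of "1 / 2"] by (simp add: \<rho>_def)
  define near where "near x j = (case prod_decode j of (k, i) \<Rightarrow> x \<in> mball (a i) (\<rho> k))" for x j
  define f where "f x = (\<Sum>j. of_bool (near x j) * (1 / 4 :: real) ^ Suc j)" for x
  define idx where "idx k y = (LEAST i. \<lfloor>4 ^ Suc (prod_encode (k, i)) * y\<rfloor> mod 4 = 1)" for k and y :: real
  define consistent where
    "consistent y \<longleftrightarrow> (\<forall>k m. d (a (idx k y)) (a (idx m y)) \<le> \<rho> k + \<rho> m)" for y
  define lim where "lim y z \<longleftrightarrow> z \<in> M \<and> (\<forall>k. d (a (idx k y)) z \<le> \<rho> k)" for y z
  define g where "g y = (if consistent y then SOME z. lim y z else a 0)" for y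
  have lim_unique: "z = z'" if "lim y z" "lim y z'" for y z z'
  proof (rule ccontr)
    assume "z \<noteq> z'"
    then have pos: "0 < d z z' / 2" using that by (simp add: lim_def)
    then obtain k where k: "\<rho> k < d z z' / 2" using \<rho>_small by blast
    have "d z z' \<le> d z (a (idx k y)) + d (a (idx k y)) z'"
      using that a_M by (intro triangle) (auto simp: lim_def)
    also have "\<dots> \<le> \<rho> k + \<rho> k"
      using that by (intro add_mono) (auto simp: lim_def commute)
    finally show False using k by simp
  qed
  have lim_exists: "\<exists>z. lim y z" if cons: "consistent y" for y
  proof -
    have "MCauchy (\<lambda>k. a (idx k y))"
      unfolding MCauchy_def
    proof (intro conjI allI impI)
      show "range (\<lambda>k. a (idx k y)) \<subseteq> M" using a_M by auto
      fix e :: real assume "0 < e"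
      then obtain N where N: "\<rho> N < e / 2" using \<rho>_small[of "e / 2"] by auto
      have "d (a (idx k y)) (a (idx m y)) < e" if "N \<le> k" "N \<le> m" for k m
      proof -
        have "\<rho> k \<le> \<rho> N" "\<rho> m \<le> \<rho> N"
          using that by (auto simp: \<rho>_def intro!: power_decreasing)
        moreover have "d (a (idx k y)) (a (idx m y)) \<le> \<rho> k + \<rho> m" using cons by (simp add: consistent_def)
        ultimately show ?thesis using N by linarith
      qed
      then show "\<exists>N. \<forall>n n'. N \<le> n \<longrightarrow> N \<le> n' \<longrightarrow> d (a (idx n y)) (a (idx n' y)) < e" by blast
    qed
    then obtain z where z: "limitin mtopology (\<lambda>k. a (idx k y)) z sequentially"
      using Md(2) unfolding mcomplete_def by blast
    then have zM: "z \<in> M" by (simp add: limitin_mspace)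
    have "d (a (idx k y)) z \<le> \<rho> k" for k
    proof (rule field_le_epsilon)
      fix e :: real assume e: "0 < e"
      have "\<forall>\<^sub>F m in sequentially. a (idx m y) \<in> M \<and> d (a (idx m y)) z < e / 2"
        using z e unfolding limitin_metric by (meson half_gt_zero)
      then have "\<forall>\<^sub>F m in sequentially. d (a (idx m y)) z < e / 2"
        by (rule eventually_mono) simp
      moreover obtain N where N: "\<rho> N < e / 2" using \<rho>_small[of "e / 2"] e by auto
      have "\<forall>\<^sub>F m in sequentially. N \<le> m" by (rule eventually_ge_at_top)
      ultimately obtain m where m: "d (a (idx m y)) z < e / 2" "N \<le> m"
        using eventually_happens'[OF sequentially_bot eventually_conj] by blast
      have "\<rho> m \<le> \<rho> N" using m(2) by (auto simp: \<rho>_def intro!: power_decreasing)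
      moreover have "d (a (idx k y)) (a (idx m y)) \<le> \<rho> k + \<rho> m" using cons by (simp add: consistent_def)
      moreover have "d (a (idx k y)) z \<le> d (a (idx k y)) (a (idx m y)) + d (a (idx m y)) z"
        using a_M zM by (intro triangle) auto
      ultimately show "d (a (idx k y)) z \<le> \<rho> k + e" using N m(1) by linarith
    qed
    with zM show ?thesis by (auto simp: lim_def)
  qed
  have g_lim: "lim y (g y)" if "consistent y" for y
    using someI_ex[OF lim_exists[OF that]] that by (simp add: g_def)
  have g_M: "g y \<in> M" for y
    using g_lim[of y] a_M by (cases "consistent y") (auto simp: lim_def g_def)
  have gf: "g (f x) = x" if x: "x \<in> M" for x
  proof -
    have "idx k (f x) = (LEAST i. x \<in> mball (a i) (\<rho> k))" for k
      unfolding idx_def f_def floor_mod_digit by (simp add: near_def)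
    moreover have "x \<in> mball (a (LEAST i. x \<in> mball (a i) (\<rho> k))) (\<rho> k)" for k
    proof -
      have "\<exists>i. x \<in> mball (a i) (\<rho> k)" using dense[OF x \<rho>, of k] x a_M by auto
      then show ?thesis by (rule LeastI_ex)
    qed
    ultimately have "x \<in> mball (a (idx k (f x))) (\<rho> k)" for k by (simp only:)
    then have near: "d (a (idx k (f x))) x < \<rho> k" for k by simp
    have "d (a (idx k (f x))) (a (idx m (f x))) \<le> \<rho> k + \<rho> m" for k m
    proof -
      have "d (a (idx k (f x))) (a (idx m (f x))) \<le> d (a (idx k (f x))) x + d x (a (idx m (f x)))"
        using a_M x by (intro triangle) auto
      then show ?thesis using near[of k] near[of m] by (simp add: commute)
    qed
    then have "consistent (f x)" by (simp add: consistent_def)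
    moreover have "lim (f x) x" using x near by (simp add: lim_def less_imp_le)
    ultimately show ?thesis using g_lim lim_unique by blast
  qed
  have f_meas: "f \<in> borel_measurable \<nu>"
  proof -
    have [measurable]: "Measurable.pred \<nu> (\<lambda>x. near x j)" for j
    proof -
      obtain k i where j: "prod_decode j = (k, i)" by (cases "prod_decode j")
      have "{x \<in> space \<nu>. near x j} = mball (a i) (\<rho> k)"
        using mball_subset_mspace[of "a i" "\<rho> k"] by (auto simp: near_def j M[symmetric])
      then show ?thesis
        using open_sets[OF openin_mball] by (simp add: pred_def)
    qed
    show ?thesis unfolding f_def by measurable
  qed
  have f_01: "f x \<in> {0..1}" for x
  proof -
    have geo: "(\<lambda>i. (1 / 4 :: real) ^ Suc i) sums (1 / 3)"
      using sums_mult[OF geometric_sums[of "1 / 4 :: real"], of "1 / 4"] by simp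
    have *: "summable (\<lambda>i. of_bool (near x i) * (1 / 4 :: real) ^ Suc i)"
      by (rule summable_comparison_test'[OF sums_summable[OF geo], of 0]) simp
    have "f x \<le> 1 / 3"
      using suminf_le[OF _ * sums_summable[OF geo]] sums_unique[OF geo] by (simp add: f_def)
    moreover have "0 \<le> f x" unfolding f_def using * by (intro suminf_nonneg) auto
    ultimately show ?thesis by simp
  qed
  have idx_meas [measurable]: "idx k \<in> borel \<rightarrow>\<^sub>M count_space UNIV" for k
    unfolding idx_def by measurable
  have consistent_meas [measurable]: "Measurable.pred borel consistent"
    unfolding consistent_def by measurable
  \<comment> \<open>Whether \<open>g y\<close> lies in an open set is decided by countably many conditions on the indices \<open>idx k y\<close>,
    whose values are natural numbers. This makes the decoder measurable.\<close>
  have preimage: "g -` U = {y. if consistent y then \<exists>k. mcball (a (idx k y)) (\<rho> k) \<subseteq> U else a 0 \<in> U}"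
    if U: "openin mtopology U" for U
  proof -
    have "g y \<in> U \<longleftrightarrow> (\<exists>k. mcball (a (idx k y)) (\<rho> k) \<subseteq> U)" if cons: "consistent y" for y
    proof
      assume "g y \<in> U"
      then obtain e where e: "0 < e" "mball (g y) e \<subseteq> U" using U unfolding openin_mtopology by blast
      then obtain k where k: "\<rho> k < e / 2" using \<rho>_small[of "e / 2"] by auto
      have "mcball (a (idx k y)) (\<rho> k) \<subseteq> mball (g y) e"
      proof
        fix z assume z: "z \<in> mcball (a (idx k y)) (\<rho> k)"
        have "d (g y) z \<le> d (g y) (a (idx k y)) + d (a (idx k y)) z"
          using z a_M g_M by (intro triangle) auto
        also have "\<dots> \<le> \<rho> k + \<rho> k"
          using z g_lim[OF cons] by (intro add_mono) (auto simp: lim_def commute)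
        finally show "z \<in> mball (g y) e" using z k g_M by auto
      qed
      with e(2) show "\<exists>k. mcball (a (idx k y)) (\<rho> k) \<subseteq> U" by blast
    next
      assume "\<exists>k. mcball (a (idx k y)) (\<rho> k) \<subseteq> U"
      then obtain k where "mcball (a (idx k y)) (\<rho> k) \<subseteq> U" ..
      moreover have "g y \<in> mcball (a (idx k y)) (\<rho> k)"
        using g_lim[OF cons] a_M by (auto simp: lim_def)
      ultimately show "g y \<in> U" by blast
    qed
    moreover have "g y = a 0" if "\<not> consistent y" for y using that by (simp add: g_def)
    ultimately have "g y \<in> U \<longleftrightarrow>
        (if consistent y then \<exists>k. mcball (a (idx k y)) (\<rho> k) \<subseteq> U else a 0 \<in> U)" for y
      by simp
    then show ?thesis by (simp only: vimage_def)
  qed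
  have g_meas: "g \<in> borel \<rightarrow>\<^sub>M \<nu>"
  proof (rule measurable_sigma_sets[OF T(4)])
    show "{U. openin T U} \<subseteq> Pow (space \<nu>)" using openin_subset T(1) by auto
    show "g \<in> space borel \<rightarrow> space \<nu>" using g_M M by auto
    fix U assume "U \<in> {U. openin T U}"
    then have "g -` U = {y. if consistent y then \<exists>k. mcball (a (idx k y)) (\<rho> k) \<subseteq> U else a 0 \<in> U}"
      using preimage Md(3) by auto
    also have "\<dots> \<in> sets borel"
    proof -
      have [measurable]: "Measurable.pred borel (\<lambda>y. mcball (a (idx k y)) (\<rho> k) \<subseteq> U)" for k
        by (rule measurable_compose[OF idx_meas]) simp
      have "Measurable.pred borel
          (\<lambda>y. if consistent y then \<exists>k. mcball (a (idx k y)) (\<rho> k) \<subseteq> U else a 0 \<in> U)"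
        by measurable
      then show ?thesis by (simp add: pred_def)
    qed
    finally show "g -` U \<inter> space borel \<in> sets borel" by simp
  qed
  show thesis
  proof
    show "f \<in> \<nu> \<rightarrow>\<^sub>M restrict_space borel {0..1}"
      using f_meas f_01 by (intro measurable_restrict_space2) auto
    show "g \<in> restrict_space borel {0..1} \<rightarrow>\<^sub>M \<nu>"
      using g_meas by (rule measurable_restrict_space1)
    show "g (f x) = x" if "x \<in> space \<nu>" for x using gf that M by simp
  qed
qed

text \<open>
Countability of this base is used twice below: it makes the product second countable, and it places
the open sets of the product in the product \<open>\<sigma>\<close>-algebra.
\<close>

lemma cylinder_base_product_topology:
  assumes I: "countable I" and B: "countable B" "\<forall>b\<in>B. openin T b"
    "\<forall>U x. openin T U \<and> x \<in> U \<longrightarrow> (\<exists>b\<in>B. x \<in> b \<and> b \<subseteq> U)"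
  defines "cyl \<equiv> \<lambda>S. {\<xi> \<in> I \<rightarrow>\<^sub>E topspace T. \<forall>(i, b)\<in>S. \<xi> i \<in> b}"
    and "\<S> \<equiv> {S. finite S \<and> S \<subseteq> I \<times> B}"
  shows "countable (cyl ` \<S>)"
    and "\<And>S. S \<in> \<S> \<Longrightarrow> openin (product_topology (\<lambda>_. T) I) (cyl S)"
    and "\<And>U \<xi>. openin (product_topology (\<lambda>_. T) I) U \<Longrightarrow> \<xi> \<in> U \<Longrightarrow> \<exists>S\<in>\<S>. \<xi> \<in> cyl S \<and> cyl S \<subseteq> U"
proof -
  let ?X = "product_topology (\<lambda>_. T) I"
  show "countable (cyl ` \<S>)"
    unfolding \<S>_def using I B(1) by (intro countable_image countable_Collect_finite_subset) auto
  show "openin ?X (cyl S)" if "S \<in> \<S>" for S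
  proof -
    have "finite S" "S \<subseteq> I \<times> B" using that by (auto simp: \<S>_def)
    then show ?thesis
    proof (induction S rule: finite_induct)
      case empty
      show ?case using openin_topspace[of ?X] by (simp add: cyl_def)
    next
      case (insert p S)
      obtain i b where p: "p = (i, b)" by force
      have "openin ?X {\<xi> \<in> topspace ?X. \<xi> i \<in> b}"
        using insert.prems p B(2)
        by (intro openin_continuous_map_preimage[OF continuous_map_product_projection]) auto
      then have "openin ?X ({\<xi> \<in> topspace ?X. \<xi> i \<in> b} \<inter> cyl S)"
        using insert by (intro openin_Int) auto
      also have "{\<xi> \<in> topspace ?X. \<xi> i \<in> b} \<inter> cyl S = cyl (insert p S)"
        by (auto simp: cyl_def p)
      finally show ?case .
    qed
  qed
  show "\<exists>S\<in>\<S>. \<xi> \<in> cyl S \<and> cyl S \<subseteq> U" if U: "openin ?X U" "\<xi> \<in> U" for U \<xi>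
  proof -
    obtain X where X: "\<xi> \<in> Pi\<^sub>E I X" "\<And>i. openin T (X i)" "finite {i. X i \<noteq> topspace T}" "Pi\<^sub>E I X \<subseteq> U"
      using product_topology_open_contains_basis[OF U] by blast
    have "\<forall>i\<in>I. \<exists>b\<in>B. \<xi> i \<in> b \<and> b \<subseteq> X i"
      using B(3) X(2) PiE_mem[OF X(1)] by blast
    then obtain b where b: "\<And>i. i \<in> I \<Longrightarrow> b i \<in> B \<and> \<xi> i \<in> b i \<and> b i \<subseteq> X i" by metis
    let ?S = "(\<lambda>i. (i, b i)) ` {i \<in> I. X i \<noteq> topspace T}"
    have "?S \<in> \<S>" using X(3) b by (auto simp: \<S>_def)
    moreover have "\<xi> \<in> cyl ?S"
    proof -
      have "\<xi> \<in> topspace ?X" using openin_subset[OF U(1)] U(2) by blast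
      then show ?thesis using b by (auto simp: cyl_def)
    qed
    moreover have "cyl ?S \<subseteq> Pi\<^sub>E I X"
    proof
      fix \<zeta> assume \<zeta>: "\<zeta> \<in> cyl ?S"
      have "\<zeta> i \<in> X i" if "i \<in> I" for i
      proof (cases "X i = topspace T")
        case True
        then show ?thesis using \<zeta> that by (auto simp: cyl_def)
      next
        case False
        then have "\<zeta> i \<in> b i" using \<zeta> that by (auto simp: cyl_def)
        then show ?thesis using b that by blast
      qed
      then show "\<zeta> \<in> Pi\<^sub>E I X" using \<zeta> by (auto simp: cyl_def PiE_iff)
    qed
    ultimately show ?thesis using X(4) by blast
  qed
qed

lemma standard_borel_PiM:
  assumes I: "countable I" and std: "standard_borel \<nu>"
  shows "standard_borel (\<Pi>\<^sub>M i\<in>I. \<nu>)"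
proof -
  from std obtain T where T: "topspace T = space \<nu>" "completely_metrizable_space T" "second_countable T"
    "sets \<nu> = sigma_sets (space \<nu>) {U. openin T U}"
    unfolding standard_borel_def by blast
  obtain B where B: "countable B" "\<forall>b\<in>B. openin T b"
    "\<forall>U x. openin T U \<and> x \<in> U \<longrightarrow> (\<exists>b\<in>B. x \<in> b \<and> b \<subseteq> U)"
    using T(3) unfolding second_countable_def by metis
  let ?X = "product_topology (\<lambda>_. T) I" and ?N = "\<Pi>\<^sub>M i\<in>I. \<nu>"
  define cyl where "cyl S = {\<xi> \<in> I \<rightarrow>\<^sub>E topspace T. \<forall>(i, b)\<in>S. \<xi> i \<in> b}" for S :: "('a \<times> 'b set) set"
  define \<S> where "\<S> = {S. finite S \<and> S \<subseteq> I \<times> B}"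
  note base = cylinder_base_product_topology[OF I B, folded cyl_def \<S>_def]
  have space_N: "space ?N = topspace ?X" by (simp add: space_PiM T(1))
  have second: "second_countable ?X"
    unfolding second_countable_def
    using base by (intro exI[of _ "cyl ` \<S>"]) (auto simp: Bex_def; metis)
  have complete: "completely_metrizable_space ?X"
    unfolding completely_metrizable_space_product_topology
    using T(2) I by (auto intro: countable_subset)
  have open_\<nu>: "b \<in> sets \<nu>" if "openin T b" for b
    unfolding T(4) using that by auto
  have cyl_sets: "cyl S \<in> sets ?N" if S: "S \<in> \<S>" for S
  proof -
    have "finite S" "S \<subseteq> I \<times> B" using S by (auto simp: \<S>_def)
    then have "{\<xi> \<in> space ?N. \<forall>p\<in>S. \<xi> (fst p) \<in> snd p} \<in> sets ?N"
      using B(2) open_\<nu>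
      by (intro sets.sets_Collect_finite_All measurable_sets_Collect[OF measurable_component_singleton]) auto
    also have "{\<xi> \<in> space ?N. \<forall>p\<in>S. \<xi> (fst p) \<in> snd p} = cyl S"
      by (auto simp: cyl_def space_PiM T(1))
    finally show ?thesis .
  qed
  have "sets ?N = sigma_sets (space ?N) {U. openin ?X U}"
  proof
    have open_sets: "U \<in> sets ?N" if U: "openin ?X U" for U
    proof -
      have "U = \<Union>{C \<in> cyl ` \<S>. C \<subseteq> U}"
        using base(3)[OF U] by blast
      also have "\<dots> \<in> sets ?N"
        using cyl_sets base(1) by (intro sets.countable_Union) (auto intro: countable_subset)
      finally show ?thesis .
    qed
    then show "sigma_sets (space ?N) {U. openin ?X U} \<subseteq> sets ?N"
      by (intro sets.sigma_sets_subset) auto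
    let ?S = "sigma (topspace ?X) {U. openin ?X U}"
    have gen: "{U. openin ?X U} \<subseteq> Pow (topspace ?X)" using openin_subset by blast
    have proj: "(\<lambda>\<xi>. \<xi> i) \<in> ?S \<rightarrow>\<^sub>M \<nu>" if i: "i \<in> I" for i
    proof (rule measurable_sigma_sets[OF T(4)])
      show "{U. openin T U} \<subseteq> Pow (space \<nu>)" using openin_subset T(1) by auto
      show "(\<lambda>\<xi>. \<xi> i) \<in> space ?S \<rightarrow> space \<nu>"
        using i gen by (auto simp: T(1))
      fix U assume "U \<in> {U. openin T U}"
      then have "openin ?X {\<xi> \<in> topspace ?X. \<xi> i \<in> U}"
        using i by (intro openin_continuous_map_preimage[OF continuous_map_product_projection]) auto
      moreover have "(\<lambda>\<xi>. \<xi> i) -` U \<inter> space ?S = {\<xi> \<in> topspace ?X. \<xi> i \<in> U}"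
        using gen by auto
      ultimately show "(\<lambda>\<xi>. \<xi> i) -` U \<inter> space ?S \<in> sets ?S"
        using gen by auto
    qed
    have "sets ?N \<subseteq> sets ?S"
    proof (rule sets_PiM_in_sets)
      show "space ?S = (\<Pi>\<^sub>E i\<in>I. space \<nu>)" using gen by (simp add: T(1))
      show "{\<xi> \<in> space ?S. \<xi> i \<in> A} \<in> sets ?S" if "i \<in> I" "A \<in> sets \<nu>" for i A
        using measurable_sets_Collect[OF proj[OF that(1)] , of "\<lambda>a. a \<in> A"] that(2) by auto
    qed
    then show "sets ?N \<subseteq> sigma_sets (space ?N) {U. openin ?X U}"
      using gen by (simp add: space_N)
  qed
  then show ?thesis
    unfolding standard_borel_def using complete second space_N by metis
qed

lemma sets_interval_eq_sigma_open:
  "sets (restrict_space borel {0..1::real}) = sigma_sets {0..1} {U. openin (top_of_set {0..1}) U}"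
proof -
  have "sets (restrict_space borel {0..1::real}) = (\<inter>) {0..1} ` sigma_sets UNIV {S. open S}"
    by (simp add: sets_restrict_space sets_borel)
  also have "\<dots> = sigma_sets {0..1} ((\<inter>) {0..1} ` {S. open S})"
    by (rule sigma_sets_Int) (auto simp: sets_borel[symmetric])
  also have "(\<inter>) {0..1::real} ` {S. open S} = {U. openin (top_of_set {0..1}) U}"
    by (auto simp: openin_open)
  finally show ?thesis .
qed

lemma standard_borel_interval:
  fixes L :: "real measure"
  assumes "sets L = sets (restrict_space borel {0..1})"
  shows "standard_borel L"
proof -
  have space: "space L = {0..1}"
    using sets_eq_imp_space_eq[OF assms] by (simp add: space_restrict_space)
  have "second_countable (euclidean :: real topology)"
  proof -
    obtain B :: "real set set" where B: "countable B" "topological_basis B"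
      using ex_countable_basis by blast
    have "\<exists>b\<in>B. x \<in> b \<and> b \<subseteq> U" if "open U" "x \<in> U" for U x
      by (rule topological_basisE[OF B(2) that]) blast
    then show ?thesis
      unfolding second_countable_def using B(1) topological_basis_open[OF B(2)]
      by (intro exI[of _ B]) auto
  qed
  then have "second_countable (top_of_set {0..1::real})" by (rule second_countable_subtopology)
  moreover have "completely_metrizable_space (top_of_set {0..1::real})"
    by (intro completely_metrizable_space_closedin completely_metrizable_space_euclidean) simp
  ultimately show ?thesis
    unfolding standard_borel_def space using assms sets_interval_eq_sigma_open
    by (intro exI[of _ "top_of_set {0..1}"]) auto
qed

section \<open>Bernoulli systems and isomorphisms between them\<close>

lemma right_shift_measure_preserving:
  assumes "group G" "prob_space \<nu>" "h \<in> carrier G"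
  shows "right_shift G h \<in> (\<Pi>\<^sub>M g\<in>carrier G. \<nu>) \<rightarrow>\<^sub>M (\<Pi>\<^sub>M g\<in>carrier G. \<nu>)"
    and "distr (\<Pi>\<^sub>M g\<in>carrier G. \<nu>) (\<Pi>\<^sub>M g\<in>carrier G. \<nu>) (right_shift G h) = (\<Pi>\<^sub>M g\<in>carrier G. \<nu>)"
proof -
  interpret group G by fact
  show "right_shift G h \<in> (\<Pi>\<^sub>M g\<in>carrier G. \<nu>) \<rightarrow>\<^sub>M (\<Pi>\<^sub>M g\<in>carrier G. \<nu>)"
    unfolding right_shift_def[abs_def] using assms(3)
    by (intro measurable_restrict measurable_component_singleton) auto
  show "distr (\<Pi>\<^sub>M g\<in>carrier G. \<nu>) (\<Pi>\<^sub>M g\<in>carrier G. \<nu>) (right_shift G h) = (\<Pi>\<^sub>M g\<in>carrier G. \<nu>)"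
    using distr_PiM_reindex[of "carrier G" "\<lambda>_. \<nu>" "\<lambda>g. g \<otimes>\<^bsub>G\<^esub> h" "carrier G"] assms(2,3)
    by (auto simp: right_shift_def[abs_def] inj_on_def)
qed

lemma distr_PiM_map:
  assumes \<nu>: "prob_space \<nu>" and f: "f \<in> \<nu> \<rightarrow>\<^sub>M N"
  shows "distr (\<Pi>\<^sub>M i\<in>I. \<nu>) (\<Pi>\<^sub>M i\<in>I. distr \<nu> N f) (\<lambda>x. \<lambda>i\<in>I. f (x i)) = (\<Pi>\<^sub>M i\<in>I. distr \<nu> N f)"
proof -
  let ?L = "distr \<nu> N f"
  have L: "prob_space ?L" using \<nu> f by (rule prob_space.prob_space_distr)
  interpret product_prob_space "\<lambda>_. ?L" I
    using L by (simp add: product_prob_space_def product_prob_space_axioms_def product_sigma_finite_def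
        prob_space_imp_sigma_finite)
  have map_meas: "(\<lambda>x. \<lambda>i\<in>I. f (x i)) \<in> (\<Pi>\<^sub>M i\<in>I. \<nu>) \<rightarrow>\<^sub>M (\<Pi>\<^sub>M i\<in>I. ?L)"
    using f by (intro measurable_restrict measurable_compose[OF measurable_component_singleton]) auto
  show ?thesis
  proof (rule PiM_eq)
    fix J F assume J: "finite J" "J \<subseteq> I" and F: "\<And>j. j \<in> J \<Longrightarrow> F j \<in> sets ?L"
    let ?F = "\<lambda>j. f -` F j \<inter> space \<nu>"
    have sets_F: "?F j \<in> sets \<nu>" if "j \<in> J" for j
      using F[OF that] f by (auto intro: measurable_sets)
    have "prod_emb I (\<lambda>_. ?L) J (Pi\<^sub>E J F) \<in> sets (\<Pi>\<^sub>M i\<in>I. ?L)"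
      using J F by (intro sets_PiM_I) auto
    then have "emeasure (distr (\<Pi>\<^sub>M i\<in>I. \<nu>) (\<Pi>\<^sub>M i\<in>I. ?L) (\<lambda>x. \<lambda>i\<in>I. f (x i))) (prod_emb I (\<lambda>_. ?L) J (Pi\<^sub>E J F))
        = emeasure (\<Pi>\<^sub>M i\<in>I. \<nu>)
            ((\<lambda>x. \<lambda>i\<in>I. f (x i)) -` prod_emb I (\<lambda>_. ?L) J (Pi\<^sub>E J F) \<inter> space (\<Pi>\<^sub>M i\<in>I. \<nu>))"
      using map_meas by (rule emeasure_distr[rotated])
    also have "(\<lambda>x. \<lambda>i\<in>I. f (x i)) -` prod_emb I (\<lambda>_. ?L) J (Pi\<^sub>E J F) \<inter> space (\<Pi>\<^sub>M i\<in>I. \<nu>)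
        = prod_emb I (\<lambda>_. \<nu>) J (Pi\<^sub>E J ?F)"
      using J measurable_space[OF f] by (auto simp: prod_emb_def space_PiM PiE_iff subset_iff)
    also have "emeasure (\<Pi>\<^sub>M i\<in>I. \<nu>) \<dots> = (\<Prod>j\<in>J. emeasure \<nu> (?F j))"
      using \<nu> J sets_F by (intro Infinite_Product_Measure.emeasure_PiM_emb) auto
    also have "\<dots> = (\<Prod>j\<in>J. emeasure ?L (F j))"
      using F f by (intro prod.cong refl) (simp add: emeasure_distr)
    finally show "emeasure (distr (\<Pi>\<^sub>M i\<in>I. \<nu>) (\<Pi>\<^sub>M i\<in>I. ?L) (\<lambda>x. \<lambda>i\<in>I. f (x i)))
        (prod_emb I (\<lambda>_. ?L) J (Pi\<^sub>E J F)) = (\<Prod>j\<in>J. emeasure ?L (F j))" .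
  qed simp
qed

lemma g_system_bernoulli:
  assumes "group G" "countable (carrier G)" "standard_borel \<nu>" "prob_space \<nu>"
  shows "g_system G (\<Pi>\<^sub>M g\<in>carrier G. \<nu>) (right_shift G)"
proof -
  interpret group G by fact
  have "right_shift G \<one>\<^bsub>G\<^esub> x = x" if "x \<in> space (\<Pi>\<^sub>M g\<in>carrier G. \<nu>)" for x
    using that by (auto simp: right_shift_def fun_eq_iff space_PiM PiE_iff extensional_def)
  moreover have "right_shift G (g \<otimes>\<^bsub>G\<^esub> h) x = right_shift G g (right_shift G h x)"
    if "g \<in> carrier G" "h \<in> carrier G" for g h and x :: "_ \<Rightarrow> 'c"
    using that by (auto simp: right_shift_def fun_eq_iff m_assoc)
  ultimately show ?thesis
    unfolding g_system_def
    using assms standard_borel_PiM right_shift_measure_preserving[OF assms(1,4)]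
    by (auto intro: prob_space_PiM)
qed

text \<open>
Applying \<open>f\<close> and \<open>g\<close> to every coordinate gives an isomorphism. The set where \<open>f (g y) = y\<close> is
measurable and contains the image of \<open>f\<close>, so it has full measure for the law of \<open>f\<close>; countably
many coordinates keep it so.
\<close>

lemma isomorphic_bernoulli_retract:
  assumes G: "group G" "countable (carrier G)" and \<nu>: "prob_space \<nu>"
    and f: "f \<in> \<nu> \<rightarrow>\<^sub>M N" and g: "g \<in> N \<rightarrow>\<^sub>M \<nu>" and gf: "\<And>x. x \<in> space \<nu> \<Longrightarrow> g (f x) = x"
    and N: "Measurable.pred N (\<lambda>y. f (g y) = y)"
  shows "isomorphic_systems G (\<Pi>\<^sub>M h\<in>carrier G. \<nu>) (right_shift G)
           (\<Pi>\<^sub>M h\<in>carrier G. distr \<nu> N f) (right_shift G)"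
proof -
  interpret group G by fact
  let ?L = "distr \<nu> N f" and ?\<Phi> = "\<lambda>x. \<lambda>h\<in>carrier G. f (x h)" and ?\<Psi> = "\<lambda>y. \<lambda>h\<in>carrier G. g (y h)"
  have L: "prob_space ?L" using \<nu> f by (rule prob_space.prob_space_distr)
  have AE_L: "AE y in ?L. f (g y) = y"
    using f N gf by (subst AE_distr_iff) (auto simp: pred_def)
  show ?thesis
    unfolding isomorphic_systems_def factor_map_def
  proof (intro exI conjI ballI)
    show "?\<Phi> \<in> (\<Pi>\<^sub>M h\<in>carrier G. \<nu>) \<rightarrow>\<^sub>M (\<Pi>\<^sub>M h\<in>carrier G. ?L)"
      using f by (intro measurable_restrict measurable_compose[OF measurable_component_singleton]) auto
    show "?\<Psi> \<in> (\<Pi>\<^sub>M h\<in>carrier G. ?L) \<rightarrow>\<^sub>M (\<Pi>\<^sub>M h\<in>carrier G. \<nu>)"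
      using g by (intro measurable_restrict measurable_compose[OF measurable_component_singleton]) auto
    show "distr (\<Pi>\<^sub>M h\<in>carrier G. \<nu>) (\<Pi>\<^sub>M h\<in>carrier G. ?L) ?\<Phi> = (\<Pi>\<^sub>M h\<in>carrier G. ?L)"
      using \<nu> f by (rule distr_PiM_map)
    show "AE x in \<Pi>\<^sub>M h\<in>carrier G. \<nu>. ?\<Phi> (right_shift G h x) = right_shift G h (?\<Phi> x)"
      if "h \<in> carrier G" for h
      using that by (intro AE_I2) (auto simp: right_shift_def fun_eq_iff)
    show "AE x in \<Pi>\<^sub>M h\<in>carrier G. \<nu>. ?\<Psi> (?\<Phi> x) = x"
      using gf by (intro AE_I2) (auto simp: fun_eq_iff space_PiM PiE_iff extensional_def)
    have "AE y in \<Pi>\<^sub>M h\<in>carrier G. ?L. \<forall>h\<in>carrier G. f (g (y h)) = y h"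
      using AE_PiM_component[of "carrier G" "\<lambda>_. ?L", OF L _ AE_L] G(2)
      by (simp add: AE_ball_countable)
    then show "AE y in \<Pi>\<^sub>M h\<in>carrier G. ?L. ?\<Phi> (?\<Psi> y) = y"
      using AE_space by eventually_elim (auto simp: fun_eq_iff space_PiM PiE_iff extensional_def)
  qed
qed

section \<open>Connected model spaces\<close>

text \<open>
If every requirement \<open>P q\<close> holds eventually, then \<open>q\<close> can be made to grow slowly with \<open>i\<close> so that
\<open>P q i\<close> holds throughout. The index is the largest \<open>q \<le> i\<close> for which \<open>P q\<close> holds from \<open>i\<close> on. Asking
for all later indices is what makes it monotone, and \<open>P 0\<close> ensures that there is such a \<open>q\<close>.
\<close>

lemma diagonal_index:
  fixes P :: "nat \<Rightarrow> nat \<Rightarrow> bool"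
  assumes ev: "\<And>q. \<forall>\<^sub>F i in sequentially. P q i" and P0: "\<And>i. P 0 i"
  obtains r where "mono r" "filterlim r at_top sequentially" "\<And>i. P (r i) i"
proof -
  define A where "A i = {q. q \<le> i \<and> (\<forall>j\<ge>i. P q j)}" for i
  have A: "finite (A i)" "0 \<in> A i" for i using P0 by (auto simp: A_def)
  have Max_A: "Max (A i) \<in> A i" for i using A by (intro Max_in) auto
  show thesis
  proof
    have "A i \<subseteq> A j" if "i \<le> j" for i j using that by (auto simp: A_def)
    then show "mono (\<lambda>i. Max (A i))"
      using A by (intro monoI Max_mono) blast+
    show "filterlim (\<lambda>i. Max (A i)) at_top sequentially"
      unfolding filterlim_at_top
    proof
      fix q
      obtain N where N: "\<And>i. N \<le> i \<Longrightarrow> P q i" using ev[of q] by (auto simp: eventually_sequentially)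
      have "q \<le> Max (A i)" if "max N q \<le> i" for i
        using that N A by (intro Max_ge) (auto simp: A_def)
      then show "\<forall>\<^sub>F i in sequentially. q \<le> Max (A i)"
        unfolding eventually_sequentially by blast
    qed
    show "P (Max (A i)) i" for i using Max_A[of i] by (auto simp: A_def)
  qed
qed

lemma successively_map_upt:
  assumes "\<And>k. a \<le> k \<Longrightarrow> Suc k < b \<Longrightarrow> R (f k) (f (Suc k))"
  shows "successively R (map f [a..<b])"
  unfolding successively_conv_nth using assms by auto

lemma delta_path_through_common_point:
  assumes R: "\<And>k. k < K \<Longrightarrow> D (x k) (x (Suc k)) < \<delta>" "\<And>k. k < K \<Longrightarrow> D (y (Suc k)) (y k) < \<delta>"
    and XY: "\<And>k. k \<le> K \<Longrightarrow> x k \<in> Y" "\<And>k. k \<le> K \<Longrightarrow> y k \<in> Y"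
    and meet: "D (x K) (y K) < \<delta>"
  shows "delta_path Y D \<delta> (x 0) (y 0) (map x [0..<Suc K] @ rev (map y [0..<Suc K]))"
proof -
  have 1: "successively (\<lambda>a b. D a b < \<delta>) (map x [0..<Suc K])"
    "successively (\<lambda>a b. D b a < \<delta>) (map y [0..<Suc K])"
    using R by (auto intro!: successively_map_upt simp del: upt_Suc)
  have 2: "hd (map x [0..<Suc K] @ zs) = x 0" "last (map x [0..<Suc K]) = x K"
    "last (map y [0..<Suc K]) = y K" "last (zs @ rev (map y [0..<Suc K])) = y 0" for zs
    by (simp_all add: hd_map hd_append last_append last_rev last_map del: upt_Suc)
  show ?thesis
    unfolding delta_path_def successively_append_iff successively_rev
    using 1 2 XY meet by (auto simp: hd_rev simp del: upt_Suc rev_map map_append)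
qed

text \<open>
The Bernoulli process with alphabet \<open>{0..1}\<close>, which suffices up to isomorphism. The measure \<open>L\<close> also
carries the measurable structure of the alphabet.
\<close>

locale interval_bernoulli =
  fixes L :: "real measure" and G :: "('g, 'b) monoid_scheme"
    and V :: "nat \<Rightarrow> 'v set" and \<sigma> :: "nat \<Rightarrow> 'g \<Rightarrow> 'v \<Rightarrow> 'v"
  assumes prob_L: "prob_space L" and sets_L: "sets L = sets (restrict_space borel {0..1})"
    and group_G: "group G" and countable_G: "countable (carrier G)"
    and sofic: "sofic_approximation G V \<sigma>"
begin

abbreviation \<mu> :: "('g \<Rightarrow> real) measure" where
  "\<mu> \<equiv> \<Pi>\<^sub>M g\<in>carrier G. L"

abbreviation emp :: "nat \<Rightarrow> ('v \<Rightarrow> real) \<Rightarrow> ('g \<Rightarrow> real) measure" where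
  "emp n x \<equiv> empirical_distribution G L (V n) (\<sigma> n) x"

lemma space_L: "space L = {0..1}"
  using sets_eq_imp_space_eq[OF sets_L] by (simp add: space_restrict_space)

lemma carrier_nonempty: "carrier G \<noteq> {}"
  using group_G group.is_monoid monoid.one_closed by blast

lemma finite_V: "finite (V n)"
  using sofic by (simp add: sofic_approximation_def)

lemma permutes_V: "g \<in> carrier G \<Longrightarrow> \<sigma> n g permutes V n"
  using sofic by (simp add: sofic_approximation_def)

lemma in_V: "g \<in> carrier G \<Longrightarrow> v \<in> V n \<Longrightarrow> \<sigma> n g v \<in> V n"
  using permutes_V permutes_in_image by metis

lemma card_V_at_top: "filterlim (\<lambda>n. card (V n)) at_top sequentially"
  using sofic by (simp add: sofic_approximation_def)

lemma inverse_card_tendsto_0: "(\<lambda>n. 1 / card (V n)) \<longlonglongrightarrow> 0"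
  using tendsto_inverse_0_at_top[OF filterlim_compose[OF filterlim_real_sequentially card_V_at_top]]
  by (simp add: inverse_eq_divide)

lemma eventually_V_nonempty: "\<forall>\<^sub>F n in sequentially. V n \<noteq> {}"
proof -
  have "\<forall>\<^sub>F n in sequentially. 1 \<le> card (V n)"
    using card_V_at_top by (simp add: filterlim_at_top)
  then show ?thesis by eventually_elim auto
qed

lemma mtopology_interval: "Metric_space.mtopology {0..1::real} dist = top_of_set {0..1}"
proof -
  interpret Submetric UNIV "dist :: real \<Rightarrow> real \<Rightarrow> real" "{0..1}"
    by unfold_locales auto
  show ?thesis using mtopology_submetric by simp
qed

lemma shift_topology_eq:
  "shift_topology G L dist = product_topology (\<lambda>_. top_of_set {0..1}) (carrier G)"
  by (simp add: shift_topology_def space_L mtopology_interval)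

lemma pullback_name_measurable:
  assumes "x \<in> V n \<rightarrow>\<^sub>E {0..1}"
  shows "(\<lambda>v. pullback_name G (\<sigma> n) v x) \<in> uniform_count_measure (V n) \<rightarrow>\<^sub>M \<mu>"
proof -
  have "(\<lambda>v. pullback_name G (\<sigma> n) v x) \<in> count_space (V n) \<rightarrow>\<^sub>M \<mu>"
    using assms in_V by (auto simp: pullback_name_def space_PiM space_L PiE_iff)
  then show ?thesis
    by (simp add: measurable_cong_sets[OF sets_uniform_count_measure_count_space refl])
qed

lemma empirical_in_prob_algebra:
  assumes "V n \<noteq> {}" "x \<in> V n \<rightarrow>\<^sub>E {0..1}"
  shows "emp n x \<in> space (prob_algebra \<mu>)"
proof -
  interpret prob_space "uniform_count_measure (V n)"
    using finite_V assms(1) by (rule prob_space_uniform_count_measure)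
  show ?thesis
    using prob_space_distr[OF pullback_name_measurable[OF assms(2)]]
    by (simp add: space_prob_algebra empirical_distribution_def)
qed

lemma integral_empirical:
  fixes f :: "('g \<Rightarrow> real) \<Rightarrow> real"
  assumes "f \<in> borel_measurable \<mu>" "x \<in> V n \<rightarrow>\<^sub>E {0..1}"
  shows "(\<integral>\<xi>. f \<xi> \<partial>emp n x) = (\<Sum>v\<in>V n. f (pullback_name G (\<sigma> n) v x)) / card (V n)"
  unfolding empirical_distribution_def
  by (simp only: integral_distr[OF pullback_name_measurable[OF assms(2)] assms(1)]
      integral_uniform_count_measure[OF finite_V])

lemma prod_list_pullback:
  "l \<in> lists (carrier G) \<Longrightarrow> (\<Prod>g\<leftarrow>l. pullback_name G s v x g) = (\<Prod>g\<leftarrow>l. x (s g v))"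
  by (induction l) (auto simp: pullback_name_def)

lemma mixed_monomial_pullback:
  "l \<in> lists (carrier G) \<Longrightarrow>
    mixed_monomial L t l (pullback_name G s v x) = mixed_monomial L t l (\<lambda>g. x (s g v))"
  unfolding mixed_monomial_def by (intro prod.cong) (auto simp: pullback_name_def)

lemma mixed_monomial_0: "mixed_monomial L 0 l \<xi> = (\<Prod>g\<leftarrow>l. \<xi> g)"
  by (simp add: mixed_monomial_def prod_list_map_eq_prod_count)

lemma continuous_mixed_monomial:
  assumes "l \<in> lists (carrier G)"
  shows "continuous_map (shift_topology G L dist) euclideanreal (mixed_monomial L t l)"
proof -
  have "continuous_map (shift_topology G L dist) euclideanreal (\<lambda>\<xi>. \<xi> g)" if "g \<in> carrier G" for g
    using continuous_map_product_projection[of g "carrier G" "\<lambda>_. top_of_set {0..1::real}"] that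
    by (simp add: continuous_map_in_subtopology shift_topology_eq)
  then show ?thesis
    unfolding mixed_monomial_def using assms
    by (intro continuous_map_prod continuous_map_add continuous_map_real_mult continuous_map_real_pow) auto
qed

lemma mixed_monomial_measurable:
  assumes "l \<in> lists (carrier G)"
  shows "mixed_monomial L t l \<in> borel_measurable \<mu>"
  using continuous_measurable[OF sets_L countable_G carrier_nonempty] continuous_mixed_monomial[OF assms]
  by (simp add: shift_topology_eq)

text \<open>
Replacing coordinates of a Bernoulli point independently by fresh symbols does not change its law.
\<close>

lemma integral_mixed_monomial:
  assumes "l \<in> lists (carrier G)"
  shows "(\<integral>\<xi>. mixed_monomial L t l \<xi> \<partial>\<mu>) = (\<integral>\<xi>. (\<Prod>g\<leftarrow>l. \<xi> g) \<partial>\<mu>)"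
proof -
  interpret prob_space L by (rule prob_L)
  note power_int = integrable_power_interval[OF prob_L sets_L]
  have "(\<integral>\<xi>. mixed_monomial L t l \<xi> \<partial>\<mu>) = (\<Prod>g\<in>set l. \<integral>a. a ^ count_list l g \<partial>L)" for t
  proof -
    have "(\<integral>\<xi>. mixed_monomial L t l \<xi> \<partial>\<mu>)
        = (\<Prod>g\<in>set l. \<integral>a. (1 - t) * a ^ count_list l g + t * (\<integral>a. a ^ count_list l g \<partial>L) \<partial>L)"
      unfolding mixed_monomial_def
      using integral_prod_distinct_coordinates[OF prob_L, of "set l" "\<lambda>g. g" "carrier G"
          "\<lambda>g a. (1 - t) * a ^ count_list l g + t * (\<integral>a. a ^ count_list l g \<partial>L)"] assms power_int
      by (auto simp: inj_on_def)
    also have "\<dots> = (\<Prod>g\<in>set l. \<integral>a. a ^ count_list l g \<partial>L)"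
      using power_int by (intro prod.cong refl) (simp add: prob_space algebra_simps)
    finally show ?thesis .
  qed
  from this[of t] this[of 0] show ?thesis by (simp add: mixed_monomial_0)
qed

lemma integral_monomial_empirical:
  assumes "l \<in> lists (carrier G)" "x \<in> V n \<rightarrow>\<^sub>E {0..1}"
  shows "(\<integral>\<xi>. (\<Prod>g\<leftarrow>l. \<xi> g) \<partial>emp n x) = (\<Sum>v\<in>V n. \<Prod>g\<leftarrow>l. x (\<sigma> n g v)) / card (V n)"
proof -
  have "(\<lambda>\<xi>. \<Prod>g\<leftarrow>l. \<xi> g) \<in> borel_measurable \<mu>"
    using mixed_monomial_measurable[OF assms(1), of 0] by (simp add: mixed_monomial_0[abs_def])
  then show ?thesis
    using integral_empirical[OF _ assms(2)] by (simp add: prod_list_pullback[OF assms(1)])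
qed

text \<open>
The average is the integral of a continuous function against the empirical distribution of \<open>x i\<close>,
so the assumed convergence controls it.
\<close>

lemma mixed_average_tendsto:
  assumes lim: "limitin (shift_weak_star G L dist) (\<lambda>i. emp (n i) (x i)) \<mu> sequentially"
    and x: "\<And>i. x i \<in> V (n i) \<rightarrow>\<^sub>E {0..1}" and l: "l \<in> lists (carrier G)"
  shows "(\<lambda>i. (\<Sum>v\<in>V (n i). mixed_monomial L t l (\<lambda>g. x i (\<sigma> (n i) g v))) / card (V (n i)))
           \<longlonglongrightarrow> (\<integral>\<xi>. (\<Prod>g\<leftarrow>l. \<xi> g) \<partial>\<mu>)"
  using limitin_weak_star_integral[OF lim continuous_mixed_monomial[OF l]] x
  by (simp add: integral_empirical[OF mixed_monomial_measurable[OF l]] mixed_monomial_pullback[OF l]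
      integral_mixed_monomial[OF l])

lemma second_moment_bound_tendsto_0:
  assumes "finite F" "F \<subseteq> carrier G"
  shows "(\<lambda>n. 4 * (2 * card {v \<in> V n. \<not> inj_on (\<lambda>g. \<sigma> n g v) F} + (card F)\<^sup>2) / card (V n)) \<longlonglongrightarrow> 0"
proof -
  have "(\<lambda>n. 8 * (card {v \<in> V n. \<not> inj_on (\<lambda>g. \<sigma> n g v) F} / card (V n)) 
        + real (4 * (card F)\<^sup>2) * (1 / card (V n))) \<longlonglongrightarrow> 8 * 0 + real (4 * (card F)\<^sup>2) * 0"
    by (intro tendsto_intros inverse_card_tendsto_0 card_noninjective_vertices_tendsto_0[OF sofic assms])
  then show ?thesis by (simp add: algebra_simps add_divide_distrib)
qed

text \<open>
The path for finitely many test monomials: start at \<open>x i\<close>, replace the symbols by fresh ones label by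
label, and return to \<open>y i\<close> in the same way, with the same \<open>\<omega>\<close>. Each step changes about \<open>1 / K\<close> of the
vertices.
\<close>

lemma eventually_path:
  fixes K :: nat
  assumes n: "strict_mono n"
    and x: "\<And>i. x i \<in> V (n i) \<rightarrow>\<^sub>E {0..1}" and y: "\<And>i. y i \<in> V (n i) \<rightarrow>\<^sub>E {0..1}"
    and lim_x: "limitin (shift_weak_star G L dist) (\<lambda>i. emp (n i) (x i)) \<mu> sequentially"
    and lim_y: "limitin (shift_weak_star G L dist) (\<lambda>i. emp (n i) (y i)) \<mu> sequentially"
    and K: "0 < K" and T: "finite T" "T \<subseteq> lists (carrier G)" and \<eta>: "0 < \<eta>"
  shows "\<forall>\<^sub>F i in sequentially. \<exists>p.
    delta_path (V (n i) \<rightarrow>\<^sub>E {0..1}) (hamming_metric (V (n i)) dist) (2 / K) (x i) (y i) p \<and>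
    (\<forall>z\<in>set p. \<forall>l\<in>T. \<bar>(\<integral>\<xi>. (\<Prod>g\<leftarrow>l. \<xi> g) \<partial>emp (n i) z) - (\<integral>\<xi>. (\<Prod>g\<leftarrow>l. \<xi> g) \<partial>\<mu>)\<bar> < \<eta>)"
proof -
  \<comment> \<open>Half of the tolerance \<open>\<eta>\<close> goes to the deviation of the averages from their means. The second bound keeps
    a step, of size at most \<open>1 / K + \<eta>'\<close>, below \<open>2 / K\<close>.\<close>
  define \<eta>' where "\<eta>' = min (\<eta> / 2) (1 / (2 * K))"
  have \<eta>': "0 < \<eta>'" "\<eta>' \<le> \<eta> / 2" "1 / K + \<eta>' < 2 / K"
    using \<eta> K by (auto simp: \<eta>'_def min_def field_simps)
  \<comment> \<open>\<open>m\<close> bounds the number of requirements on \<open>\<omega>\<close> when there are two colourings.\<close>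
  define m where "m = real (2 * (Suc K * card T) + K)"
  define c where "c = \<eta>'\<^sup>2 / (2 * m)"
  have m: "0 < m" unfolding m_def of_nat_0_less_iff using K by simp
  have c: "0 < c" "m * c < \<eta>'\<^sup>2"
    using m \<eta>' by (auto simp: c_def field_simps)
  have one: "\<one>\<^bsub>G\<^esub> \<in> carrier G" using group_G by (simp add: group.is_monoid monoid.one_closed)
  have sub: "filterlim n sequentially sequentially" using n by (rule filterlim_subseq)
  have F: "finite F" "F \<subseteq> carrier G" if "F \<in> insert {\<one>\<^bsub>G\<^esub>} (set ` T)" for F
    using that T(2) one by auto
  have "\<forall>\<^sub>F n in sequentially. \<forall>F\<in>insert {\<one>\<^bsub>G\<^esub>} (set ` T).
      4 * (2 * card {v \<in> V n. \<not> inj_on (\<lambda>g. \<sigma> n g v) F} + (card F)\<^sup>2) / card (V n) < c"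
    using T(1) F c(1) by (intro eventually_ball_finite ballI order_tendstoD(2)[OF second_moment_bound_tendsto_0]) auto
  then have ev_c: "\<forall>\<^sub>F i in sequentially. \<forall>F\<in>insert {\<one>\<^bsub>G\<^esub>} (set ` T).
      4 * (2 * card {v \<in> V (n i). \<not> inj_on (\<lambda>g. \<sigma> (n i) g v) F} + (card F)\<^sup>2) / card (V (n i)) < c"
    by (rule eventually_compose_filterlim[OF _ sub])
  have ev_avg: "\<forall>\<^sub>F i in sequentially. \<forall>k\<in>{..K}. \<forall>l\<in>T.
      \<bar>(\<Sum>v\<in>V (n i). mixed_monomial L (k / K) l (\<lambda>g. z i (\<sigma> (n i) g v))) / card (V (n i))
        - (\<integral>\<xi>. (\<Prod>g\<leftarrow>l. \<xi> g) \<partial>\<mu>)\<bar> < \<eta> / 2"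
    if z: "\<And>i. z i \<in> V (n i) \<rightarrow>\<^sub>E {0..1}"
      "limitin (shift_weak_star G L dist) (\<lambda>i. emp (n i) (z i)) \<mu> sequentially" for z
  proof (intro eventually_ball_finite ballI)
    fix k l assume "l \<in> T"
    then have "l \<in> lists (carrier G)" using T(2) by blast
    from tendstoD[OF mixed_average_tendsto[OF z(2,1) this], of "\<eta> / 2" "k / K"] \<eta>
    show "\<forall>\<^sub>F i in sequentially.
      \<bar>(\<Sum>v\<in>V (n i). mixed_monomial L (k / K) l (\<lambda>g. z i (\<sigma> (n i) g v))) / card (V (n i))
        - (\<integral>\<xi>. (\<Prod>g\<leftarrow>l. \<xi> g) \<partial>\<mu>)\<bar> < \<eta> / 2"
      by (simp add: dist_real_def)
  qed (use T in auto)
  have ev_ne: "\<forall>\<^sub>F i in sequentially. V (n i) \<noteq> {}"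
    by (rule eventually_compose_filterlim[OF eventually_V_nonempty sub])
  show ?thesis
    using ev_c ev_ne ev_avg[OF x lim_x] ev_avg[OF y lim_y]
  proof eventually_elim
    case (elim i)
    let ?V = "V (n i)"
    have "card {x i, y i} \<le> 2" by (simp add: card_insert_le_m1)
    then have "real (card {x i, y i} * (Suc K * card T) + K) \<le> m"
      unfolding m_def by (intro of_nat_mono add_right_mono mult_right_mono) auto
    then have c_less: "real (card {x i, y i} * (Suc K * card T) + K) * c < \<eta>'\<^sup>2"
      using c by (smt (verit) mult_right_mono)
    obtain \<omega> where \<omega>: "\<omega> \<in> ?V \<rightarrow>\<^sub>E {0..1} \<times> {..<K}"
      and close: "\<And>z k l. z \<in> {x i, y i} \<Longrightarrow> k \<le> K \<Longrightarrow> l \<in> T \<Longrightarrow>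
       \<bar>(\<Sum>v\<in>?V. \<Prod>g\<leftarrow>l. mixture ?V \<omega> k z (\<sigma> (n i) g v)) / card ?V
         - (\<Sum>v\<in>?V. mixed_monomial L (k / K) l (\<lambda>g. z (\<sigma> (n i) g v))) / card ?V\<bar> < \<eta>'"
      and step: "\<And>k. k < K \<Longrightarrow> \<bar>card {v \<in> ?V. snd (\<omega> v) = k} / card ?V - 1 / K\<bar> < \<eta>'"
    proof (rule exists_typical_mixture[of L ?V "carrier G" "\<sigma> (n i)" K T "\<one>\<^bsub>G\<^esub>" "{x i, y i}" \<eta>' c])
      show "4 * (2 * card {v \<in> ?V. \<not> inj_on (\<lambda>g. \<sigma> (n i) g v) F} + (card F)\<^sup>2) / card ?V \<le> c"
        if "F \<in> insert {\<one>\<^bsub>G\<^esub>} (set ` T)" for F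
        using elim(1) that by (meson less_imp_le)
    qed (use prob_L sets_L finite_V elim(2) permutes_V K T one x y \<eta>'(1) c_less in auto)
    let ?x = "\<lambda>k. mixture ?V \<omega> k (x i)" and ?y = "\<lambda>k. mixture ?V \<omega> k (y i)"
    have hstep: "hamming_metric ?V dist (mixture ?V \<omega> k z) (mixture ?V \<omega> (Suc k) z) < 2 / K"
      if "k < K" "z \<in> {x i, y i}" for k z
      using hamming_mixture_step[OF finite_V _ \<omega>, of z k] step[OF that(1)] that(2) x y \<eta>'(3) by auto
    let ?p = "map ?x [0..<Suc K] @ rev (map ?y [0..<Suc K])"
    have "delta_path (?V \<rightarrow>\<^sub>E {0..1}) (hamming_metric ?V dist) (2 / K) (?x 0) (?y 0) ?p"
    proof (rule delta_path_through_common_point)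
      show "hamming_metric ?V dist (?x K) (?y K) < 2 / K"
        using mixture_top[OF \<omega>, of "x i" "y i"] K by (simp add: hamming_metric_def)
      show "hamming_metric ?V dist (?x k) (?x (Suc k)) < 2 / K" if "k < K" for k
        using hstep[OF that] by simp
      show "hamming_metric ?V dist (?y (Suc k)) (?y k) < 2 / K" if "k < K" for k
        using hstep[OF that, of "y i"] by (simp add: hamming_metric_commute)
      show "?x k \<in> ?V \<rightarrow>\<^sub>E {0..1}" "?y k \<in> ?V \<rightarrow>\<^sub>E {0..1}" for k
        by (rule mixture_in[OF x \<omega>], rule mixture_in[OF y \<omega>])
    qed
    then have path: "delta_path (?V \<rightarrow>\<^sub>E {0..1}) (hamming_metric ?V dist) (2 / K) (x i) (y i) ?p"
      using mixture_0[OF x] mixture_0[OF y] by metis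
    have good: "\<bar>(\<integral>\<xi>. (\<Prod>g\<leftarrow>l. \<xi> g) \<partial>emp (n i) (mixture ?V \<omega> k z)) - (\<integral>\<xi>. (\<Prod>g\<leftarrow>l. \<xi> g) \<partial>\<mu>)\<bar> < \<eta>"
      if kl: "k \<le> K" "l \<in> T" and z: "z \<in> {x i, y i}" for k l z
    proof -
      have "mixture ?V \<omega> k z \<in> ?V \<rightarrow>\<^sub>E {0..1}" "l \<in> lists (carrier G)"
        using mixture_in[OF x \<omega>] mixture_in[OF y \<omega>] z kl T(2) by blast+
      note integral_monomial_empirical[OF this(2,1)]
      moreover have "\<bar>(\<Sum>v\<in>?V. mixed_monomial L (k / K) l (\<lambda>g. z (\<sigma> (n i) g v))) / card ?V
          - (\<integral>\<xi>. (\<Prod>g\<leftarrow>l. \<xi> g) \<partial>\<mu>)\<bar> < \<eta> / 2"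
        using elim(3,4) kl z by auto
      ultimately show ?thesis
        using close[OF z kl] \<eta>'(2) by linarith
    qed
    have "set ?p \<subseteq> (\<lambda>(k, z). mixture ?V \<omega> k z) ` ({..K} \<times> {x i, y i})"
      by (auto simp: less_Suc_eq_le simp del: upt_Suc)
    then have "\<forall>z\<in>set ?p. \<forall>l\<in>T. \<bar>(\<integral>\<xi>. (\<Prod>g\<leftarrow>l. \<xi> g) \<partial>emp (n i) z) - (\<integral>\<xi>. (\<Prod>g\<leftarrow>l. \<xi> g) \<partial>\<mu>)\<bar> < \<eta>"
      using good by fastforce
    with path show ?case by blast
  qed
qed

text \<open>
The monomials over the countable group are countable in number, so the paths for the first \<open>q\<close> of
them, with tolerance and step size of order \<open>1 / q\<close>, can be combined by letting \<open>q\<close> grow slowly with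
\<open>i\<close>. For \<open>q = 0\<close> the two-point path already qualifies, which covers the small \<open>i\<close>.
\<close>

lemma bernoulli_has_connected_model_spaces: "process_has_connected_model_spaces G V \<sigma> L dist \<mu>"
  unfolding process_has_connected_model_spaces_def space_L
proof (intro allI impI)
  fix n x y
  assume n: "strict_mono n"
    and x: "\<forall>i. x i \<in> V (n i) \<rightarrow>\<^sub>E {0..1}" and y: "\<forall>i. y i \<in> V (n i) \<rightarrow>\<^sub>E {0..1}"
    and lim_x: "limitin (shift_weak_star G L dist) (\<lambda>i. emp (n i) (x i)) \<mu> sequentially"
    and lim_y: "limitin (shift_weak_star G L dist) (\<lambda>i. emp (n i) (y i)) \<mu> sequentially"
  let ?D = "\<lambda>i. hamming_metric (V (n i)) dist :: ('v \<Rightarrow> real) \<Rightarrow> _"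
  let ?l = "from_nat_into (lists (carrier G))"
  have enum: "countable (lists (carrier G))" "lists (carrier G) \<noteq> {}"
    using countable_G by (auto intro: lists.Nil)
  have l: "?l j \<in> lists (carrier G)" for j using enum(2) by (rule from_nat_into)
  define P where "P q i p \<longleftrightarrow> delta_path (V (n i) \<rightarrow>\<^sub>E {0..1}) (?D i) (2 / Suc q) (x i) (y i) p \<and>
    (\<forall>z\<in>set p. \<forall>j<q. \<bar>(\<integral>\<xi>. (\<Prod>g\<leftarrow>?l j. \<xi> g) \<partial>emp (n i) z) - (\<integral>\<xi>. (\<Prod>g\<leftarrow>?l j. \<xi> g) \<partial>\<mu>)\<bar> < 1 / Suc q)"
    for q i p
  have ev: "\<forall>\<^sub>F i in sequentially. \<exists>p. P q i p" for q
    using eventually_path[OF n x[rule_format] y[rule_format] lim_x lim_y, of "Suc q" "?l ` {..<q}" "1 / Suc q"] l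
    by (auto simp: P_def image_subset_iff elim!: eventually_mono)
  have P0: "\<exists>p. P 0 i p" for i
  proof -
    have "(\<Sum>v\<in>V (n i). dist (x i v) (y i v)) \<le> (\<Sum>v\<in>V (n i). 1)"
      using x y by (intro sum_mono) (fastforce simp: PiE_iff dist_real_def abs_le_iff)
    then have "?D i (x i) (y i) < 2"
      by (cases "card (V (n i)) = 0") (auto simp: hamming_metric_def field_simps)
    then have "P 0 i [x i, y i]"
      using x y by (simp add: P_def delta_path_def)
    then show ?thesis ..
  qed
  obtain r where r: "mono r" "filterlim r at_top sequentially" "\<And>i. \<exists>p. P (r i) i p"
    using diagonal_index[of "\<lambda>q i. \<exists>p. P q i p", OF ev P0] by blast
  from r(3) obtain p where p: "\<And>i. P (r i) i (p i)" by metis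
  define \<delta> where "\<delta> i = 2 / Suc (r i)" for i
  have inv_r: "(\<lambda>i. 1 / Suc (r i)) \<longlonglongrightarrow> 0"
    using filterlim_compose[OF LIMSEQ_inverse_real_of_nat r(2)] by (simp add: inverse_eq_divide)
  show "\<exists>\<delta> p. (\<forall>i. 0 < \<delta> i) \<and> decseq \<delta> \<and> \<delta> \<longlonglongrightarrow> 0 \<and>
       (\<forall>i. delta_path (V (n i) \<rightarrow>\<^sub>E {0..1}) (?D i) (\<delta> i) (x i) (y i) (p i)) \<and>
       (\<forall>U. openin (shift_weak_star G L dist) U \<and> \<mu> \<in> U \<longrightarrow>
         (\<forall>\<^sub>F i in sequentially. set (p i) \<subseteq> good_models G L U (V (n i)) (\<sigma> (n i))))"
  proof (intro exI conjI allI impI)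
    show "0 < \<delta> i" for i by (simp add: \<delta>_def)
    show "decseq \<delta>"
      using r(1) by (auto simp: decseq_def \<delta>_def mono_def intro!: divide_left_mono)
    show "\<delta> \<longlonglongrightarrow> 0"
      using tendsto_mult[OF tendsto_const[of 2] inv_r] by (simp add: \<delta>_def[abs_def])
    show path: "delta_path (V (n i) \<rightarrow>\<^sub>E {0..1}) (?D i) (\<delta> i) (x i) (y i) (p i)" for i
      using p[of i] by (simp add: P_def \<delta>_def)
    fix U assume U: "openin (shift_weak_star G L dist) U \<and> \<mu> \<in> U"
    \<comment> \<open>An empty vertex set carries no empirical distribution; this can occur only for finitely many \<open>i\<close>.\<close>
    define \<P> where "\<P> i = (if V (n i) = {} then {} else emp (n i) ` set (p i))" for i
    have in_p: "z \<in> V (n i) \<rightarrow>\<^sub>E {0..1}" if "z \<in> set (p i)" for i z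
      using path[of i] that by (auto simp: delta_path_def)
    have "\<forall>\<^sub>F i in sequentially. \<P> i \<subseteq> U"
    proof (rule eventually_in_weak_star_nbhd[OF sets_L countable_G carrier_nonempty])
      show "Q \<in> space (prob_algebra \<mu>)" if "Q \<in> \<P> i" for i Q
      proof -
        from that obtain z where "V (n i) \<noteq> {}" "z \<in> set (p i)" "Q = emp (n i) z"
          by (auto simp: \<P>_def split: if_splits)
        then show ?thesis using empirical_in_prob_algebra in_p by blast
      qed
      show "\<mu> \<in> space (prob_algebra \<mu>)"
        by (simp add: space_prob_algebra prob_space_PiM prob_L)
      show "openin (weak_star_topology (product_topology (\<lambda>_. top_of_set {0..1}) (carrier G)) \<mu>) U" "\<mu> \<in> U"
        using U by (simp_all add: shift_topology_eq)
      fix l' :: "'g list" and \<epsilon> :: real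
      assume l': "l' \<in> lists (carrier G)" and \<epsilon>: "0 < \<epsilon>"
      from l' enum obtain j where j: "l' = ?l j"
        by (metis from_nat_into_surj)
      have "\<forall>\<^sub>F i in sequentially. Suc j \<le> r i"
        using r(2) by (simp add: filterlim_at_top)
      moreover have "\<forall>\<^sub>F i in sequentially. 1 / Suc (r i) < \<epsilon>"
        using inv_r \<epsilon> by (rule order_tendstoD)
      ultimately show "\<forall>\<^sub>F i in sequentially. \<forall>Q\<in>\<P> i.
          \<bar>(\<integral>\<xi>. (\<Prod>g\<leftarrow>l'. \<xi> g) \<partial>Q) - (\<integral>\<xi>. (\<Prod>g\<leftarrow>l'. \<xi> g) \<partial>\<mu>)\<bar> < \<epsilon>"
      proof eventually_elim
        case (elim i)
        show ?case
        proof
          fix Q assume "Q \<in> \<P> i"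
          then obtain z where z: "z \<in> set (p i)" "Q = emp (n i) z"
            by (auto simp: \<P>_def split: if_splits)
          have "\<bar>(\<integral>\<xi>. (\<Prod>g\<leftarrow>?l j. \<xi> g) \<partial>emp (n i) z) - (\<integral>\<xi>. (\<Prod>g\<leftarrow>?l j. \<xi> g) \<partial>\<mu>)\<bar> < 1 / Suc (r i)"
            using p[of i] z(1) elim(1) unfolding P_def by (metis Suc_le_eq)
          then show "\<bar>(\<integral>\<xi>. (\<Prod>g\<leftarrow>l'. \<xi> g) \<partial>Q) - (\<integral>\<xi>. (\<Prod>g\<leftarrow>l'. \<xi> g) \<partial>\<mu>)\<bar> < \<epsilon>"
            using elim(2) z(2) j by simp
        qed
      qed
    qed
    moreover have "\<forall>\<^sub>F i in sequentially. V (n i) \<noteq> {}"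
      using eventually_compose_filterlim[OF eventually_V_nonempty filterlim_subseq[OF n]] .
    ultimately show "\<forall>\<^sub>F i in sequentially. set (p i) \<subseteq> good_models G L U (V (n i)) (\<sigma> (n i))"
      by eventually_elim (use in_p in \<open>auto simp: good_models_def \<P>_def space_L\<close>)
  qed
qed

lemma metric_process_bernoulli: "metric_process G L dist \<mu>"
  unfolding metric_process_def space_L mtopology_interval
proof (intro conjI ballI)
  show "standard_borel L" using sets_L by (rule standard_borel_interval)
  show "Metric_space {0..1::real} dist"
    using Metric_space.subspace[OF Met_TC.Metric_space_axioms, of "{0..1}"] by simp
  show "compact_space (top_of_set {0..1::real})" by (simp add: compact_space_subtopology)
  show "sets L = sigma_sets {0..1} {U. openin (top_of_set {0..1}) U}"
    using sets_L sets_interval_eq_sigma_open by (rule trans)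
  show "\<mu> \<in> space (prob_algebra \<mu>)"
    by (simp add: space_prob_algebra prob_space_PiM prob_L)
  show "distr \<mu> \<mu> (right_shift G h) = \<mu>" if "h \<in> carrier G" for h
    using group_G prob_L that by (rule right_shift_measure_preserving(2))
qed

end

theorem theoremC:
  fixes G :: "('g, 'b) monoid_scheme"
    and V :: "nat \<Rightarrow> 'v set"
    and \<sigma> :: "nat \<Rightarrow> 'g \<Rightarrow> 'v \<Rightarrow> 'v"
    and \<nu> :: "'x measure"
  assumes "group G"
    and "countable (carrier G)"
    and "sofic_approximation G V \<sigma>"
    and "standard_borel \<nu>"
    and "prob_space \<nu>"
  shows "has_connected_model_spaces G V \<sigma> (Pi\<^sub>M (carrier G) (\<lambda>_. \<nu>)) (right_shift G)"
proof -
  let ?I = "restrict_space borel {0..1::real}"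
  obtain f g where f: "f \<in> \<nu> \<rightarrow>\<^sub>M ?I" and g: "g \<in> ?I \<rightarrow>\<^sub>M \<nu>"
    and gf: "\<And>x. x \<in> space \<nu> \<Longrightarrow> g (f x) = x"
    using standard_borel_retract_of_interval[OF assms(4) prob_space.not_empty[OF assms(5)]] by blast
  let ?L = "distr \<nu> ?I f"
  have fg: "Measurable.pred ?I (\<lambda>y. f (g y) = y)"
  proof -
    have "(\<lambda>y. f (g y)) \<in> borel_measurable ?I"
      using measurable_compose[OF g f] by (simp add: measurable_restrict_space2_iff)
    moreover have "(\<lambda>y. y) \<in> borel_measurable ?I"
      by (intro measurable_restrict_space1) simp
    ultimately show ?thesis by simp
  qed
  interpret interval_bernoulli ?L G V \<sigma>
    by (rule interval_bernoulli.intro[OF prob_space.prob_space_distr[OF assms(5) f] _ assms(1-3)]) simp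
  show ?thesis
    unfolding has_connected_model_spaces_def
  proof (intro conjI exI)
    show "g_system G (\<Pi>\<^sub>M g\<in>carrier G. \<nu>) (right_shift G)"
      using assms(1,2,4,5) by (rule g_system_bernoulli)
    show "metric_process G ?L dist \<mu>"
      by (rule metric_process_bernoulli)
    show "isomorphic_systems G (\<Pi>\<^sub>M g\<in>carrier G. \<nu>) (right_shift G) \<mu> (right_shift G)"
      using assms(1,2,5) f g gf fg by (rule isomorphic_bernoulli_retract)
    show "process_has_connected_model_spaces G V \<sigma> ?L dist \<mu>"
      by (rule bernoulli_has_connected_model_spaces)
  qed
qed

end
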